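(* For every $\lambda$-theory $\mathcal T$, $\mathrm{FHP}/\mathcal T$ (the set of $\mathcal T$-equivalence classes of finite hereditary permutations) is a submonoid of $(\Lambda/\mathcal T,\circ)$ which is an $F$-inverse monoid.
   Context: $\Lambda$ is the set of $\lambda$-terms; $\mathbf I=\lambda x.x$, $\mathbf B=\lambda fgx.f(gx)$, $M\circ N:=\mathbf BMN$, which induces an associative operation on $\Lambda/\mathcal T$ for any $\lambda$-theory $\mathcal T$ (an equivalence on $\Lambda$ containing $\beta$-conversion, compatible with application and abstraction). For each variable $x$, $\mathscr{HP}(x)$ is the largest set of Böhm-like trees such that every $T\in\mathscr{HP}(x)$ has the form $\lambda x_1\ldots x_n.x\,T_1\cdots T_n$ (root $\lambda x_1\dots x_n.x$, children $T_i$, $x_i$ fresh) for some $n$, some permutation $\pi$ of $\{1,\dots,n\}$, and $T_i\in\mathscr{HP}(x_{\pi i})$; $\mathscr{HP}=\{\lambda x.T:T\in\mathscr{HP}(x)\}$; $\mathrm{FHP}$ is the set of $\lambda$-terms whose Böhm tree is a finite element of $\mathscr{HP}$. An inverse monoid is a monoid with a unary operation $^*$ satisfying $(u^* )^*=u$, $(uv)^*=v^*u^*$, $uu^*u=u$, $uu^*vv^*=vv^*uu^*$; natural order $u\le v$ iff $uu^*v=u$; $\sigma_S$ is the relation $t\,\sigma_S\,u$ iff there is $w$ with $w\le t$ and $w\le u$; $S$ is $F$-inverse if every $\sigma_S$-class has a unique maximal element. *)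

theory Defs
  imports
    "HOL-Algebra.Group"
    "HOL-Combinatorics.Permutations"
begin

section \<open>Lambda-terms and lambda-theories\<close>

text \<open>Lambda-terms up to alpha-conversion, in de Bruijn notation. Terms may be open: an index that
  exceeds the number of enclosing abstractions is a free variable.\<close>

datatype trm = Var nat | App trm trm | Abs trm

primrec lift :: "trm \<Rightarrow> nat \<Rightarrow> trm" where
  "lift (Var i) k = (if i < k then Var i else Var (Suc i))"
| "lift (App s t) k = App (lift s k) (lift t k)"
| "lift (Abs s) k = Abs (lift s (Suc k))"

text \<open>\<open>subst t s k\<close> replaces the index \<open>k\<close> by \<open>s\<close> in \<open>t\<close> and decrements the indices above \<open>k\<close>,
  as needed for contracting a redex.\<close>

primrec subst :: "trm \<Rightarrow> trm \<Rightarrow> nat \<Rightarrow> trm" where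
  "subst (Var i) s k = (if k < i then Var (i - 1) else if i = k then s else Var i)"
| "subst (App t u) s k = App (subst t s k) (subst u s k)"
| "subst (Abs t) s k = Abs (subst t (lift s 0) (Suc k))"

inductive beta :: "trm \<Rightarrow> trm \<Rightarrow> bool" where
  redex: "beta (App (Abs s) t) (subst s t 0)"
| appL: "beta s s' \<Longrightarrow> beta (App s t) (App s' t)"
| appR: "beta t t' \<Longrightarrow> beta (App s t) (App s t')"
| abs: "beta s s' \<Longrightarrow> beta (Abs s) (Abs s')"

abbreviation beta_conv :: "trm \<Rightarrow> trm \<Rightarrow> bool" where
  "beta_conv \<equiv> equivclp beta"

text \<open>The inconsistent theory \<open>UNIV\<close> is included.\<close>

definition lambda_theory :: "(trm \<times> trm) set \<Rightarrow> bool" where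
  "lambda_theory T \<longleftrightarrow>
     equiv UNIV T \<and>
     (\<forall>M N. beta_conv M N \<longrightarrow> (M, N) \<in> T) \<and>
     (\<forall>M M' N N'. (M, M') \<in> T \<longrightarrow> (N, N') \<in> T \<longrightarrow> (App M N, App M' N') \<in> T) \<and>
     (\<forall>M N. (M, N) \<in> T \<longrightarrow> (Abs M, Abs N) \<in> T)"

definition comb_I :: trm where
  "comb_I = Abs (Var 0)"

definition comb_B :: trm where
  "comb_B = Abs (Abs (Abs (App (Var 2) (App (Var 1) (Var 0)))))"

definition term_comp :: "trm \<Rightarrow> trm \<Rightarrow> trm" where
  "term_comp M N = App (App comb_B M) N"

text \<open>The set of all terms modulo \<open>T\<close> with the operation induced by composition. The class of
  \<open>comb_I\<close> is in general not neutral on the whole carrier (this needs eta), so this record is a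
  semigroup with a distinguished element and need not satisfy \<open>monoid\<close>.\<close>

definition term_quot :: "(trm \<times> trm) set \<Rightarrow> trm set monoid" where
  "term_quot T =
     \<lparr>carrier = UNIV // T,
      monoid.mult = (\<lambda>X Y. \<Union>M\<in>X. \<Union>N\<in>Y. T `` {term_comp M N}),
      one = T `` {comb_I}\<rparr>"


section \<open>Boehm trees\<close>

text \<open>\<open>Node n k Ts\<close> is the tree with root \<open>\<lambda>x\<^sub>1\<dots>x\<^sub>n. y\<close> and children \<open>Ts\<close>, where \<open>k\<close> is the index of
  \<open>y\<close> inside the \<open>n\<close> abstractions. The indices in the children also refer to this inner scope, in
  which \<open>x\<^sub>i\<close> has index \<open>n - i\<close>.\<close>

codatatype btree = Bot | Node nat nat "btree list"

text \<open>The head normal form \<open>\<lambda>x\<^sub>1\<dots>x\<^sub>n. y M\<^sub>1 \<dots> M\<^sub>m\<close>.\<close>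

definition hnf :: "nat \<Rightarrow> nat \<Rightarrow> trm list \<Rightarrow> trm" where
  "hnf n k Ms = (Abs ^^ n) (foldl App (Var k) Ms)"

definition has_hnf :: "trm \<Rightarrow> bool" where
  "has_hnf M \<longleftrightarrow> (\<exists>n k Ms. beta_conv M (hnf n k Ms))"

text \<open>By confluence, all head normal forms of \<open>M\<close> have the same \<open>n\<close>, \<open>k\<close> and number of arguments,
  and corresponding arguments are beta-convertible. Hence the choice made here does not affect the
  Boehm tree.\<close>

definition some_hnf :: "trm \<Rightarrow> nat \<times> nat \<times> trm list" where
  "some_hnf M = (SOME (n, k, Ms). beta_conv M (hnf n k Ms))"

primcorec BT :: "trm \<Rightarrow> btree" where
  "BT M = (if has_hnf M
           then Node (fst (some_hnf M)) (fst (snd (some_hnf M))) (map BT (snd (snd (some_hnf M))))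
           else Bot)"

text \<open>Nodes have finitely many children, so well-foundedness amounts to finiteness.\<close>

inductive finite_btree :: "btree \<Rightarrow> bool" where
  "finite_btree Bot"
| "(\<And>T. T \<in> set Ts \<Longrightarrow> finite_btree T) \<Longrightarrow> finite_btree (Node n k Ts)"

fun abs_btree :: "btree \<Rightarrow> btree" where
  "abs_btree Bot = Bot"
| "abs_btree (Node n k Ts) = Node (Suc n) k Ts"


section \<open>Hereditary permutations\<close>

text \<open>\<open>HP_at x T\<close>: the tree \<open>T\<close> belongs to the largest set of trees attached to the free variable
  with index \<open>x\<close>. Under the \<open>n\<close> abstractions of the root this variable has index \<open>x + n\<close>, and
  \<open>x\<^bsub>\<pi> i\<^esub>\<close> has index \<open>n - \<pi> i\<close>.\<close>

coinductive HP_at :: "nat \<Rightarrow> btree \<Rightarrow> bool" where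
  "\<lbrakk>\<pi> permutes {1..n}; length Ts = n; \<forall>i\<in>{1..n}. HP_at (n - \<pi> i) (Ts ! (i - 1))\<rbrakk>
   \<Longrightarrow> HP_at x (Node n (x + n) Ts)"

definition HP :: "btree set" where
  "HP = {abs_btree T | T. HP_at 0 T}"

definition FHP :: "trm set" where
  "FHP = {M. BT M \<in> HP \<and> finite_btree (BT M)}"


section \<open>Inverse monoids\<close>

definition inverse_monoid :: "('a, 'b) monoid_scheme \<Rightarrow> ('a \<Rightarrow> 'a) \<Rightarrow> bool" where
  "inverse_monoid S star \<longleftrightarrow>
     monoid S \<and> star \<in> carrier S \<rightarrow> carrier S \<and>
     (\<forall>u\<in>carrier S. star (star u) = u) \<and>
     (\<forall>u\<in>carrier S. \<forall>v\<in>carrier S. star (u \<otimes>\<^bsub>S\<^esub> v) = star v \<otimes>\<^bsub>S\<^esub> star u) \<and>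
     (\<forall>u\<in>carrier S. u \<otimes>\<^bsub>S\<^esub> star u \<otimes>\<^bsub>S\<^esub> u = u) \<and>
     (\<forall>u\<in>carrier S. \<forall>v\<in>carrier S.
        (u \<otimes>\<^bsub>S\<^esub> star u) \<otimes>\<^bsub>S\<^esub> (v \<otimes>\<^bsub>S\<^esub> star v) = (v \<otimes>\<^bsub>S\<^esub> star v) \<otimes>\<^bsub>S\<^esub> (u \<otimes>\<^bsub>S\<^esub> star u))"

definition natural_le :: "('a, 'b) monoid_scheme \<Rightarrow> ('a \<Rightarrow> 'a) \<Rightarrow> 'a \<Rightarrow> 'a \<Rightarrow> bool" where
  "natural_le S star u v \<longleftrightarrow> u \<otimes>\<^bsub>S\<^esub> star u \<otimes>\<^bsub>S\<^esub> v = u"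

definition sigma :: "('a, 'b) monoid_scheme \<Rightarrow> ('a \<Rightarrow> 'a) \<Rightarrow> ('a \<times> 'a) set" where
  "sigma S star = {(t, u). t \<in> carrier S \<and> u \<in> carrier S \<and>
     (\<exists>w\<in>carrier S. natural_le S star w t \<and> natural_le S star w u)}"

definition F_inverse_monoid :: "('a, 'b) monoid_scheme \<Rightarrow> ('a \<Rightarrow> 'a) \<Rightarrow> bool" where
  "F_inverse_monoid S star \<longleftrightarrow>
     inverse_monoid S star \<and>
     (\<forall>C\<in>carrier S // sigma S star.
        \<exists>!m. m \<in> C \<and> (\<forall>v\<in>C. natural_le S star m v \<longrightarrow> v = m))"

end

(* Modulo beta a finite hereditary permutation is a finite tree of permutations, and composition
   becomes an operation on such trees which makes them an inverse monoid: the idempotents are the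
   eta-expansions of the identity, and the star inverts all permutations. Every quotient of an
   inverse monoid is one. The order u <= v says that u is an eta-expansion of v, so undoing all
   eta-expansions gives a largest element above a tree, and it depends only on the permutations.
   These are constant on the sigma-classes, even modulo a consistent theory: an equation
   between two terms with different permutations is refuted by Boehm's separation technique. *)

theory Submission
  imports Defs "HOL-Library.Confluence"
begin

section \<open>Confluence and uniqueness of head normal forms\<close>

text \<open>Without eta, the expansions of one permutation tree are different terms, and a product
  has to keep the larger of the two arities. Trees are therefore functions on addresses that
  continue with identities beyond the arity: trees of different arities are then composed and
  compared by one formula. The price is that finiteness and induction rest on a depth bound. A
  theory may well identify trees of different arities, as eta does, so an equation between terms
  cannot reveal arities; it can reveal permutations. Hence the greatest element of a class has to
  come from a construction that reads permutations only. In the quotient, \<open>w\<close> being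
  below \<open>t\<close> only says that \<open>w w* t\<close> and \<open>w\<close> are equal modulo
  the theory. Since all permutations of \<open>w w*\<close> are identities, separation turns this
  into honest equality of the permutations of \<open>w\<close> and \<open>t\<close>.\<close>

lemma lift_lift: "i \<le> k \<Longrightarrow> lift (lift t i) (Suc k) = lift (lift t k) i"
  by (induction t arbitrary: i k) auto

lemma lift_subst: "j \<le> i \<Longrightarrow> lift (subst t s j) i = subst (lift t (Suc i)) (lift s i) j"
  by (induction t arbitrary: i j s) (auto simp: diff_Suc lift_lift split: nat.split)

lemma lift_subst_ge: "i \<le> j \<Longrightarrow> lift (subst t s j) i = subst (lift t i) (lift s i) (Suc j)"
  by (induction t arbitrary: i j s) (auto simp: lift_lift)

lemma subst_lift [simp]: "subst (lift t k) s k = t"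
  by (induction t arbitrary: k s) auto

lemma subst_subst:
  "i \<le> j \<Longrightarrow> subst (subst t (lift v i) (Suc j)) (subst u v j) i = subst (subst t u i) v j"
  by (induction t arbitrary: i j u v)
    (auto simp: diff_Suc lift_lift[symmetric] lift_subst_ge split: nat.split)

section \<open>Parallel reduction in the style of Tait and Martin-Loef\<close>

inductive par :: "trm \<Rightarrow> trm \<Rightarrow> bool" where
  par_Var: "par (Var i) (Var i)"
| par_App: "par s s' \<Longrightarrow> par t t' \<Longrightarrow> par (App s t) (App s' t')"
| par_Abs: "par s s' \<Longrightarrow> par (Abs s) (Abs s')"
| par_redex: "par s s' \<Longrightarrow> par t t' \<Longrightarrow> par (App (Abs s) t) (subst s' t' 0)"

inductive_cases par_VarE: "par (Var i) t"
inductive_cases par_AbsE: "par (Abs s) t"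
inductive_cases par_AppE: "par (App s t) u"

lemma par_refl: "par t t"
  by (induction t) (auto intro: par.intros)

lemma beta_imp_par: "beta s t \<Longrightarrow> par s t"
  by (induction rule: beta.induct) (auto intro: par.intros par_refl)

lemma par_lift: "par s t \<Longrightarrow> par (lift s k) (lift t k)"
  by (induction arbitrary: k rule: par.induct) (auto intro: par.intros simp: lift_subst)

lemma par_subst: "par s s' \<Longrightarrow> par t t' \<Longrightarrow> par (subst s t k) (subst s' t' k)"
proof (induction arbitrary: t t' k rule: par.induct)
  case (par_redex s s' u u')
  have "par (App (Abs (subst s (lift t 0) (Suc k))) (subst u t k))
     (subst (subst s' (lift t' 0) (Suc k)) (subst u' t' k) 0)"
    using par_redex by (intro par.par_redex) (auto intro: par_lift)
  then show ?case by (simp add: subst_subst)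
next
  case (par_Abs s s')
  then show ?case by (simp add: par.par_Abs par_lift)
qed (auto intro: par.intros par_lift)

text \<open>Takahashi's complete development: all redexes present in the term are contracted at
  once. A parallel step contracts some of them, and contracting the rest leads to this common
  reduct, which depends on the source only.\<close>

fun dev :: "trm \<Rightarrow> trm" where
  "dev (Var i) = Var i"
| "dev (Abs s) = Abs (dev s)"
| "dev (App (Abs s) t) = subst (dev s) (dev t) 0"
| "dev (App s t) = App (dev s) (dev t)"

lemma par_dev: "par s t \<Longrightarrow> par t (dev s)"
proof (induction rule: par.induct)
  case (par_App s s' t t')
  then show ?case
    by (cases s) (auto intro: par.intros elim!: par_AbsE)
qed (auto intro: par.intros par_subst)

lemma equivclp_mono: "equivclp r x y \<Longrightarrow> r \<le> equivclp q \<Longrightarrow> equivclp q x y"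
proof (induction rule: equivclp_induct)
  case (step y z)
  then have "equivclp q y z" by (blast dest: predicate2D equivclp_sym)
  then show ?case using step by (blast intro: equivclp_trans)
qed simp

abbreviation conv (infix "\<leftrightarrow>\<^sub>\<beta>" 50) where
  "M \<leftrightarrow>\<^sub>\<beta> N \<equiv> beta_conv M N"

lemma conv_App: "M \<leftrightarrow>\<^sub>\<beta> M' \<Longrightarrow> N \<leftrightarrow>\<^sub>\<beta> N' \<Longrightarrow> App M N \<leftrightarrow>\<^sub>\<beta> App M' N'"
proof -
  assume M: "M \<leftrightarrow>\<^sub>\<beta> M'" and N: "N \<leftrightarrow>\<^sub>\<beta> N'"
  have "App M N \<leftrightarrow>\<^sub>\<beta> App M' N"
    using M by (induction rule: equivclp_induct) (auto intro: beta.intros equivclp_into_equivclp)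
  also have "App M' N \<leftrightarrow>\<^sub>\<beta> App M' N'"
    using N by (induction rule: equivclp_induct) (auto intro: beta.intros equivclp_into_equivclp)
  finally show ?thesis .
qed

lemma conv_Abs: "M \<leftrightarrow>\<^sub>\<beta> M' \<Longrightarrow> Abs M \<leftrightarrow>\<^sub>\<beta> Abs M'"
  by (induction rule: equivclp_induct) (auto intro: beta.intros equivclp_into_equivclp)

lemma conv_redex: "App (Abs s) t \<leftrightarrow>\<^sub>\<beta> subst s t 0"
  by (rule r_into_equivclp) (rule beta.redex)

lemma par_imp_conv: "par s t \<Longrightarrow> s \<leftrightarrow>\<^sub>\<beta> t"
  by (induction rule: par.induct)
    (blast intro: equivclp_refl conv_App conv_Abs equivclp_trans[OF conv_App[OF conv_Abs] conv_redex])+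

text \<open>Church-Rosser: two parallel steps from one term meet again in its complete development,
  and every beta-conversion is also a conversion for \<open>par\<close>.\<close>

lemma conv_imp_par_joinable:
  assumes "M \<leftrightarrow>\<^sub>\<beta> N"
  obtains P where "par\<^sup>*\<^sup>* M P" "par\<^sup>*\<^sup>* N P"
proof -
  have "strong_confluentp par"
    by (rule strong_confluentpI) (blast intro: par_dev)
  then have "semiconfluentp par"
    by (rule strong_confluentp_into_semiconfluentp)
  moreover have "equivclp par M N"
    using assms by (rule equivclp_mono) (auto intro: beta_imp_par)
  ultimately show ?thesis
    using that by (auto simp: semiconfluentp_equivclp rtranclp_conversep)
qed

section \<open>Head normal forms under reduction, and Boehm trees\<close>

lemma par_Abs_pow: "par ((Abs ^^ n) M) N \<Longrightarrow> \<exists>M'. N = (Abs ^^ n) M' \<and> par M M'"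
proof (induction n arbitrary: N)
  case (Suc n)
  then show ?case by (auto elim!: par_AbsE)
qed auto

lemma foldl_App_not_Abs: "foldl App (Var k) Ms \<noteq> Abs M"
  by (cases Ms rule: rev_cases) auto

lemma par_foldl_App:
  "par (foldl App (Var k) Ms) N \<Longrightarrow> \<exists>Ms'. N = foldl App (Var k) Ms' \<and> list_all2 par Ms Ms'"
proof (induction Ms arbitrary: N rule: rev_induct)
  case Nil
  then show ?case by (auto elim: par_VarE)
next
  case (snoc M Ms)
  from snoc.prems obtain N1 N2 where N: "N = App N1 N2" "par (foldl App (Var k) Ms) N1" "par M N2"
    by (auto elim!: par_AppE simp: foldl_App_not_Abs)
  obtain Ms' where "N1 = foldl App (Var k) Ms'" "list_all2 par Ms Ms'"
    using snoc.IH[OF N(2)] by auto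
  then show ?case
    using N by (intro exI[of _ "Ms' @ [N2]"]) (auto intro: list_all2_appendI)
qed

text \<open>All redexes of a head normal form lie inside its arguments, so no reduction can touch
  the prefix, the head variable or the number of arguments.\<close>

lemma par_hnf:
  assumes "par\<^sup>*\<^sup>* (hnf n k Ms) N"
  shows "\<exists>Ms'. N = hnf n k Ms' \<and> list_all2 beta_conv Ms Ms'"
  using assms
proof (induction rule: rtranclp_induct)
  case base
  then show ?case by (auto simp: list_all2_same)
next
  case (step P N)
  then obtain Ms' where Ms': "P = hnf n k Ms'" "list_all2 beta_conv Ms Ms'" by auto
  obtain Q where Q: "N = (Abs ^^ n) Q" "par (foldl App (Var k) Ms') Q"
    using step.hyps(2) par_Abs_pow unfolding Ms' hnf_def by blast
  obtain Ms'' where Ms'': "Q = foldl App (Var k) Ms''" "list_all2 par Ms' Ms''"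
    using par_foldl_App[OF Q(2)] by blast
  have "list_all2 beta_conv Ms' Ms''"
    using Ms''(2) by (rule list.rel_mono_strong) (rule par_imp_conv)
  then have "list_all2 beta_conv Ms Ms''"
    using Ms'(2) by (auto simp: list_all2_conv_all_nth) (blast intro: equivclp_trans)
  then show ?case
    using Q(1) Ms''(1) by (auto simp: hnf_def)
qed

lemma foldl_App_inject:
  "foldl App (Var k) Ms = foldl App (Var k') Ms' \<longleftrightarrow> k = k' \<and> Ms = Ms'"
proof (induction Ms arbitrary: Ms' rule: rev_induct)
  case Nil
  then show ?case by (cases Ms' rule: rev_cases) auto
next
  case (snoc M Ms)
  then show ?case by (cases Ms' rule: rev_cases) auto
qed

lemma hnf_inject: "hnf n k Ms = hnf n' k' Ms' \<longleftrightarrow> n = n' \<and> k = k' \<and> Ms = Ms'"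
proof -
  have "hnf n k Ms = hnf n' k' Ms' \<Longrightarrow> n = n'"
  proof (induction n arbitrary: n')
    case 0
    then show ?case by (cases n') (auto simp: hnf_def foldl_App_not_Abs)
  next
    case (Suc n)
    then show ?case by (cases n') (auto simp: hnf_def foldl_App_not_Abs[symmetric])
  qed
  moreover have "(Abs ^^ n) M = (Abs ^^ n) M' \<longleftrightarrow> M = M'" for M M'
    by (induction n) auto
  ultimately show ?thesis
    by (auto simp: hnf_def foldl_App_inject)
qed

lemma hnf_conv_hnf:
  assumes "hnf n k Ms \<leftrightarrow>\<^sub>\<beta> hnf n' k' Ms'"
  shows "n = n' \<and> k = k' \<and> list_all2 beta_conv Ms Ms'"
proof -
  obtain P where "par\<^sup>*\<^sup>* (hnf n k Ms) P" "par\<^sup>*\<^sup>* (hnf n' k' Ms') P"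
    using conv_imp_par_joinable[OF assms] by blast
  then obtain Ns where "n = n'" "k = k'" "list_all2 beta_conv Ms Ns" "list_all2 beta_conv Ms' Ns"
    by (auto dest!: par_hnf simp: hnf_inject)
  then show ?thesis
    by (auto simp: list_all2_conv_all_nth) (blast intro: equivclp_trans equivclp_sym)
qed

lemma some_hnf_conv: "has_hnf M \<Longrightarrow> some_hnf M = (n, k, Ms) \<Longrightarrow> M \<leftrightarrow>\<^sub>\<beta> hnf n k Ms"
  unfolding has_hnf_def some_hnf_def
  using someI[of "\<lambda>(n, k, Ms). M \<leftrightarrow>\<^sub>\<beta> hnf n k Ms"] by fastforce

text \<open>The existential list absorbs the arbitrary choice in \<open>some_hnf\<close>: the
  subtrees belong to the chosen arguments, which uniqueness of head normal forms makes convertible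
  to the given ones.\<close>

lemma BT_hnf:
  assumes "M \<leftrightarrow>\<^sub>\<beta> hnf n k Ms"
  shows "\<exists>Ms'. BT M = Node n k (map BT Ms') \<and> list_all2 beta_conv Ms Ms'"
proof -
  have h: "has_hnf M" using assms by (auto simp: has_hnf_def)
  obtain n' k' Ms' where s: "some_hnf M = (n', k', Ms')" by (cases "some_hnf M")
  have "hnf n k Ms \<leftrightarrow>\<^sub>\<beta> hnf n' k' Ms'"
    using equivclp_trans[OF equivclp_sym[OF assms] some_hnf_conv[OF h s]] .
  then show ?thesis
    using hnf_conv_hnf[of n k Ms n' k' Ms'] s h BT.code[of M] by auto
qed

lemma BT_Node_imp_conv:
  assumes "BT M = Node n k Ts"
  shows "\<exists>Ms. M \<leftrightarrow>\<^sub>\<beta> hnf n k Ms \<and> Ts = map BT Ms"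
proof -
  have h: "has_hnf M" using assms BT.code[of M] by (auto split: if_splits)
  obtain n' k' Ms' where s: "some_hnf M = (n', k', Ms')" by (cases "some_hnf M")
  then show ?thesis
    using some_hnf_conv[OF h s] assms h BT.code[of M] by auto
qed

section \<open>The combinatorial inverse monoid\<close>

text \<open>A possibly infinite hereditary permutation maps each address of its tree to the number of
  children and the permutation of the node at that address. Positions are counted from \<open>0\<close>.\<close>

type_synonym hp = "nat list \<Rightarrow> nat \<times> (nat \<Rightarrow> nat)"

abbreviation arity :: "hp \<Rightarrow> nat" where "arity a \<equiv> fst (a [])"

abbreviation perm :: "hp \<Rightarrow> nat \<Rightarrow> nat" where "perm a \<equiv> snd (a [])"

definition child :: "hp \<Rightarrow> nat \<Rightarrow> hp" where "child a i = (\<lambda>w. a (i # w))"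

definition hp_one :: hp where "hp_one = (\<lambda>w. (0, id))"

text \<open>If \<open>M = \<lambda>x x\<^sub>1\<dots>x\<^sub>n. x (M\<^sub>1 x\<^bsub>\<pi> 1\<^esub>) \<dots> (M\<^sub>n x\<^bsub>\<pi> n\<^esub>)\<close> and \<open>N\<close> is given likewise by \<open>\<rho>\<close> and the \<open>N\<^sub>i\<close>, then
  \<open>M \<circ> N\<close> has the permutation \<open>\<pi> \<circ> \<rho>\<close> and the children \<open>N\<^sub>i \<circ> M\<^bsub>\<rho> i\<^esub>\<close>, where missing children are
  identities. Note that the order flips from one level to the next.\<close>

fun hp_comp :: "hp \<Rightarrow> hp \<Rightarrow> hp" where
  "hp_comp a b [] = (max (arity a) (arity b), perm a \<circ> perm b)"
| "hp_comp a b (i # w) = hp_comp (child b i) (child a (perm b i)) w"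

text \<open>The child at \<open>i\<close> is taken from the preimage of \<open>i\<close> so that
  child \<open>i\<close> of \<open>hp_comp a (hp_inv a)\<close> becomes
  \<open>hp_comp (hp_inv c) c\<close>, where \<open>c\<close> is the child of \<open>a\<close> at
  that preimage.\<close>

fun hp_inv :: "hp \<Rightarrow> hp" where
  "hp_inv a [] = (arity a, inv_into UNIV (perm a))"
| "hp_inv a (i # w) = hp_inv (child a (inv_into UNIV (perm a) i)) w"

text \<open>\<open>hp_trim\<close> undoes all eta-expansions: trailing children that are expanded identities at
  their own position are removed.\<close>

definition hp_trim :: "hp \<Rightarrow> hp" where
  "hp_trim a w =
     (LEAST k. \<forall>i\<ge>k. snd (a w) i = i \<and> (\<forall>v. snd (a (w @ i # v)) = id), snd (a w))"

text \<open>An address function has no structural induction of its own; the bound supplies one.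
  Beyond the arity everything is forced to be the identity, so each finite tree has exactly one
  representation.\<close>

primrec hp_depth :: "nat \<Rightarrow> hp \<Rightarrow> bool" where
  "hp_depth 0 a \<longleftrightarrow> a = hp_one"
| "hp_depth (Suc d) a \<longleftrightarrow> perm a permutes {..<arity a} \<and> (\<forall>i\<ge>arity a. child a i = hp_one) \<and>
     (\<forall>i. hp_depth d (child a i))"

definition fhp :: "hp set" where "fhp = {a. \<exists>d. hp_depth d a}"

lemma child_hp_one [simp]: "child hp_one i = hp_one"
  by (simp add: child_def hp_one_def)

lemma hp_one_apply [simp]: "hp_one [] = (0, id)" "hp_one (i # w) = (0, id)"
  by (simp_all add: hp_one_def)

lemma child_apply: "a (i # w) = child a i w"
  by (simp add: child_def)

lemma child_hp_comp [simp]: "child (hp_comp a b) i = hp_comp (child b i) (child a (perm b i))"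
  by (simp add: child_def[of "hp_comp a b"])

lemma child_hp_inv [simp]: "child (hp_inv a) i = hp_inv (child a (inv_into UNIV (perm a) i))"
  by (simp add: child_def[of "hp_inv a"])

lemma child_hp_trim [simp]: "child (hp_trim a) i = hp_trim (child a i)"
  by (rule ext) (simp add: child_def hp_trim_def)

lemma perm_hp_trim [simp]: "perm (hp_trim a) = perm a"
  by (simp add: hp_trim_def)

lemma hp_depth_Suc: "hp_depth d a \<Longrightarrow> hp_depth (Suc d) a"
proof (induction d arbitrary: a)
  case 0
  then show ?case by simp
next
  case (Suc d)
  from Suc.prems have "perm a permutes {..<arity a}" "\<forall>i\<ge>arity a. child a i = hp_one"
    "\<forall>i. hp_depth d (child a i)" by auto
  then show ?case using Suc.IH by (subst hp_depth.simps(2)) blast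
qed

lemma hp_depth_mono: "hp_depth d a \<Longrightarrow> d \<le> e \<Longrightarrow> hp_depth e a"
  by (rule dec_induct[of d e "\<lambda>e. hp_depth e a"]) (auto intro: hp_depth_Suc simp del: hp_depth.simps)

lemma hp_one_fhp [simp]: "hp_one \<in> fhp"
  unfolding fhp_def by (auto intro: exI[of _ 0])

lemma fhpD:
  assumes "a \<in> fhp"
  shows "perm a permutes {..<arity a}" "arity a \<le> i \<Longrightarrow> child a i = hp_one" "child a i \<in> fhp"
proof -
  obtain d where "hp_depth d a" using assms by (auto simp: fhp_def)
  then have "hp_depth (Suc d) a" by (rule hp_depth_Suc)
  then show "perm a permutes {..<arity a}" "arity a \<le> i \<Longrightarrow> child a i = hp_one" "child a i \<in> fhp"
    by (auto simp: fhp_def)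
qed

lemma fhpI:
  assumes "perm a permutes {..<arity a}" "\<And>i. arity a \<le> i \<Longrightarrow> child a i = hp_one"
    and "\<And>i. i < arity a \<Longrightarrow> child a i \<in> fhp"
  shows "a \<in> fhp"
proof -
  have "\<exists>d. hp_depth d (child a i)" for i
    using assms(2,3)[of i] hp_one_fhp unfolding fhp_def by (cases "i < arity a") auto
  then obtain d where d: "\<And>i. hp_depth (d i) (child a i)" by metis
  define e where "e = Max (insert 0 (d ` {..<arity a}))"
  have "hp_depth e (child a i)" for i
  proof (cases "i < arity a")
    case True
    then have "d i \<le> e" unfolding e_def by (intro Max_ge) auto
    then show ?thesis using d hp_depth_mono by blast
  next
    case False
    then have "hp_depth 0 (child a i)" using assms(2) by simp
    then show ?thesis using hp_depth_mono by blast
  qed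
  then have "hp_depth (Suc e) a" using assms by simp
  then show ?thesis unfolding fhp_def by blast
qed

lemma fhp_induct [consumes 1, case_names hp_one step]:
  assumes "a \<in> fhp" "P hp_one" "\<And>a. a \<in> fhp \<Longrightarrow> (\<And>i. P (child a i)) \<Longrightarrow> P a"
  shows "P a"
proof -
  obtain d where "hp_depth d a" using assms(1) by (auto simp: fhp_def)
  then show ?thesis
  proof (induction d arbitrary: a)
    case (Suc d)
    have "a \<in> fhp" using Suc.prems unfolding fhp_def by blast
    moreover have "P (child a i)" for i using Suc by auto
    ultimately show ?case by (rule assms(3))
  qed (simp add: assms(2))
qed

text \<open>The hypothesis exchanges the roles of the trees because composition reverses its factors
  at each edge. A common depth bound for both trees makes it available for every pair of
  children.\<close>

lemma fhp_induct2 [consumes 2, case_names hp_one step]: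
  assumes "a \<in> fhp" "b \<in> fhp" "P hp_one hp_one"
    and "\<And>a b. a \<in> fhp \<Longrightarrow> b \<in> fhp \<Longrightarrow> (\<And>i j. P (child b i) (child a j)) \<Longrightarrow> P a b"
  shows "P a b"
proof -
  obtain d e where "hp_depth d a" "hp_depth e b" using assms(1,2) by (auto simp: fhp_def)
  then obtain f where "hp_depth f a" "hp_depth f b"
    using hp_depth_mono[of d a "max d e"] hp_depth_mono[of e b "max d e"] by auto
  then show ?thesis
  proof (induction f arbitrary: a b)
    case (Suc f)
    have "a \<in> fhp" "b \<in> fhp" using Suc.prems unfolding fhp_def by blast+
    moreover have "P (child b i) (child a j)" for i j
      using Suc by auto
    ultimately show ?case by (rule assms(4))
  qed (simp add: assms(3))
qed

section \<open>Monoid laws, closure and trimming\<close>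

lemma hp_comp_one_left [simp]: "hp_comp hp_one a = a"
  and hp_comp_one_right [simp]: "hp_comp a hp_one = a"
proof -
  have "hp_comp hp_one a w = a w \<and> hp_comp a hp_one w = a w" for w
    by (induction w arbitrary: a) (auto simp: child_apply)
  then show "hp_comp hp_one a = a" "hp_comp a hp_one = a" by auto
qed

lemma hp_comp_assoc: "hp_comp (hp_comp a b) c = hp_comp a (hp_comp b c)"
proof
  have "hp_comp (hp_comp a b) c w = hp_comp a (hp_comp b c) w" for w
    by (induction w arbitrary: a b c) (auto simp: max.assoc)
  then show "hp_comp (hp_comp a b) c w = hp_comp a (hp_comp b c) w" for w .
qed

lemma hp_inv_one [simp]: "hp_inv hp_one = hp_one"
proof
  show "hp_inv hp_one w = hp_one w" for w by (induction w) (auto simp: child_apply)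
qed

lemma hp_comp_fhp: "a \<in> fhp \<Longrightarrow> b \<in> fhp \<Longrightarrow> hp_comp a b \<in> fhp"
proof (induction a b rule: fhp_induct2)
  case (step a b)
  note a = fhpD[OF step.hyps(1)] and b = fhpD[OF step.hyps(2)]
  have p: "perm a permutes {..<max (arity a) (arity b)}" "perm b permutes {..<max (arity a) (arity b)}"
    using a(1) b(1) by (auto intro: permutes_subset)
  show ?case
  proof (rule fhpI)
    show "perm (hp_comp a b) permutes {..<arity (hp_comp a b)}"
      using permutes_compose[OF p(2,1)] by simp
    show "child (hp_comp a b) i = hp_one" if "arity (hp_comp a b) \<le> i" for i
    proof -
      have "perm b i = i" using that permutes_not_in[OF p(2), of i] by (auto simp: less_max_iff_disj)
      then show ?thesis using that a(2)[of i] b(2)[of i] by simp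
    qed
    show "child (hp_comp a b) i \<in> fhp" for i using step.IH by simp
  qed
qed simp

lemma hp_inv_fhp: "a \<in> fhp \<Longrightarrow> hp_inv a \<in> fhp"
proof (induction a rule: fhp_induct)
  case (step a)
  note a = fhpD[OF step.hyps]
  have p: "inv_into UNIV (perm a) permutes {..<arity a}" using a(1) by (rule permutes_inv)
  show ?case
    by (rule fhpI) (use p step.IH a(2) permutes_not_in[OF p] in simp_all)
qed simp

text \<open>The actual arity is a candidate for the \<open>LEAST\<close> in \<open>hp_trim\<close>.
  The empty address in front is kept so that the statement matches that definition unfolded at the
  root.\<close>

lemma fhp_beyond_arity:
  assumes "a \<in> fhp"
  shows "\<forall>i\<ge>arity a. perm a i = i \<and> (\<forall>v. snd (a ([] @ i # v)) = id)"
proof safe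
  fix i assume i: "arity a \<le> i"
  show "perm a i = i" using i permutes_not_in[OF fhpD(1)[OF assms]] by simp
  fix v
  show "snd (a ([] @ i # v)) = id"
    using fhpD(2)[OF assms i] by (simp add: child_apply) (simp add: hp_one_def)
qed

lemma arity_hp_trim:
  assumes "a \<in> fhp"
  shows "arity (hp_trim a) \<le> arity a"
  unfolding hp_trim_def fst_conv by (rule Least_le) (rule fhp_beyond_arity[OF assms])

lemma arity_hp_trim_spec:
  assumes "a \<in> fhp" "arity (hp_trim a) \<le> i"
  shows "perm a i = i" "snd (child a i v) = id"
proof -
  let ?P = "\<lambda>k. \<forall>i\<ge>k. perm a i = i \<and> (\<forall>v. snd (a ([] @ i # v)) = id)"
  have "?P (LEAST k. ?P k)"
    using fhp_beyond_arity[OF assms(1)] by (rule LeastI[where P = ?P])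
  moreover have "(LEAST k. ?P k) \<le> i" using assms(2) by (simp only: hp_trim_def fst_conv)
  ultimately have "perm a i = i \<and> (\<forall>v. snd (a ([] @ i # v)) = id)" by blast
  then show "perm a i = i" "snd (child a i v) = id" by (simp_all add: child_def)
qed

lemma hp_trim_eq_one:
  assumes "\<And>w. snd (a w) = id"
  shows "hp_trim a = hp_one"
  by (rule ext) (simp add: hp_trim_def assms Least_eq_0 hp_one_def)

text \<open>The positions cut off are fixed points, so the permutation still acts on the shorter
  interval, and the children there trim to \<open>hp_one\<close>.\<close>

lemma hp_trim_fhp: "a \<in> fhp \<Longrightarrow> hp_trim a \<in> fhp"
proof (induction a rule: fhp_induct)
  case hp_one
  have "hp_trim hp_one = hp_one" by (rule hp_trim_eq_one) (simp add: hp_one_def)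
  then show ?case by simp
next
  case (step a)
  note spec = arity_hp_trim_spec[OF step.hyps]
  show ?case
  proof (rule fhpI)
    have "perm a permutes {..<arity (hp_trim a)}"
      by (rule permutes_superset[OF fhpD(1)[OF step.hyps]]) (use spec(1) not_less in auto)
    then show "perm (hp_trim a) permutes {..<arity (hp_trim a)}" by simp
    show "child (hp_trim a) i = hp_one" if "arity (hp_trim a) \<le> i" for i
      using spec(2)[OF that] by (simp add: hp_trim_eq_one)
    show "child (hp_trim a) i \<in> fhp" for i using step.IH by simp
  qed
qed

text \<open>The new arities are computed from the permutations alone; the old ones never enter. Thus
  the permutations recovered by separation determine the trimmed tree completely.\<close>

lemma hp_trim_cong: "snd \<circ> a = snd \<circ> b \<Longrightarrow> hp_trim a = hp_trim b"
  by (rule ext) (simp add: hp_trim_def fun_eq_iff)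

text \<open>Compositions flip along edges, so each identity is proved together with its mirror image.\<close>

lemma hp_comp_trim:
  assumes "a \<in> fhp"
  shows "hp_comp (hp_comp a (hp_inv a)) (hp_trim a) = a"
    and "hp_comp (hp_trim a) (hp_comp (hp_inv a) a) = a"
proof -
  have "hp_comp (hp_comp a (hp_inv a)) (hp_trim a) w = a w \<and>
    hp_comp (hp_trim a) (hp_comp (hp_inv a) a) w = a w" for w
    using assms
  proof (induction w arbitrary: a)
    \<comment> \<open>The trimmed arity is at most the old one, so the maximum taken by composition
      restores exactly the arity that trimming removed.\<close>
    case Nil
    then show ?case
      using permutes_inverses[OF fhpD(1)[OF Nil]] arity_hp_trim[OF Nil]
      by (auto simp: prod_eq_iff fun_eq_iff)
  next
    case (Cons i w)
    then show ?case
      using permutes_inverses[OF fhpD(1)[OF Cons.prems]] fhpD(3)[OF Cons.prems, of i] Cons.IH[of "child a i"]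
      by (simp add: child_apply[of a i w])
  qed
  then show "hp_comp (hp_comp a (hp_inv a)) (hp_trim a) = a"
    "hp_comp (hp_trim a) (hp_comp (hp_inv a) a) = a" by auto
qed

lemma hp_comp_inv:
  assumes "a \<in> fhp"
  shows "hp_comp (hp_comp a (hp_inv a)) a = a"
proof -
  have "hp_comp (hp_comp a (hp_inv a)) a w = a w \<and>
    hp_comp a (hp_comp (hp_inv a) a) w = a w" for w
    using assms
  proof (induction w arbitrary: a)
    case Nil
    then show ?case
      using permutes_inverses[OF fhpD(1)[OF Nil]]
      by (auto simp: prod_eq_iff fun_eq_iff)
  next
    case (Cons i w)
    then show ?case
      using permutes_inverses[OF fhpD(1)[OF Cons.prems]] fhpD(3)[OF Cons.prems, of i] Cons.IH[of "child a i"]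
      by (simp add: child_apply[of a i w])
  qed
  then show ?thesis by auto
qed

lemma hp_inv_inv:
  assumes "a \<in> fhp"
  shows "hp_inv (hp_inv a) = a"
proof
  show "hp_inv (hp_inv a) w = a w" for w
    using assms
  proof (induction w arbitrary: a)
    case Nil
    then show ?case by (simp add: permutes_inv_inv[OF fhpD(1)[OF Nil]])
  next
    case (Cons i w)
    then show ?case
      using permutes_inverses[OF fhpD(1)[OF Cons.prems]] fhpD(3)[OF Cons.prems, of i] Cons.IH[of "child a i"]
      by (simp add: permutes_inv_inv[OF fhpD(1)[OF Cons.prems]] child_apply[of a i w])
  qed
qed

lemma hp_inv_comp:
  assumes "a \<in> fhp" "b \<in> fhp"
  shows "hp_inv (hp_comp a b) = hp_comp (hp_inv b) (hp_inv a)"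
proof
  show "hp_inv (hp_comp a b) w = hp_comp (hp_inv b) (hp_inv a) w" for w
    using assms
  proof (induction w arbitrary: a b)
    case Nil
    then show ?case
      using o_inv_distrib[of "perm a" "perm b"]
      by (auto dest!: fhpD(1) permutes_bij)
  next
    case (Cons i w)
    have "inv_into UNIV (perm a \<circ> perm b) i = inv_into UNIV (perm b) (inv_into UNIV (perm a) i)"
      using o_inv_distrib[of "perm a" "perm b"] Cons.prems
      by (auto dest!: fhpD(1) permutes_bij)
    then show ?case
      using permutes_inverses[OF fhpD(1)[OF Cons.prems(2)]]
      by (simp add: Cons.IH Cons.prems fhpD(3))
  qed
qed

section \<open>Eta-expansions of the identity\<close>

lemma perm_hp_comp_inv:
  assumes "a \<in> fhp"
  shows "snd (hp_comp a (hp_inv a) w) = id" "snd (hp_comp (hp_inv a) a w) = id"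
proof -
  have "snd (hp_comp a (hp_inv a) w) = id \<and> snd (hp_comp (hp_inv a) a w) = id"
    using assms
  proof (induction w arbitrary: a)
    case Nil
    then show ?case by (auto simp: permutes_inv_o[OF fhpD(1)])
  next
    case (Cons i w)
    then show ?case using permutes_inverses[OF fhpD(1)[OF Cons.prems]]
      by (auto intro: fhpD(3))
  qed
  then show "snd (hp_comp a (hp_inv a) w) = id" "snd (hp_comp (hp_inv a) a w) = id" by auto
qed

text \<open>When all permutations are identities, composition only takes the maximum of the arities
  node by node.\<close>

lemma hp_comp_commute:
  assumes "\<And>w. snd (a w) = id" "\<And>w. snd (b w) = id"
  shows "hp_comp a b = hp_comp b a"
proof
  show "hp_comp a b w = hp_comp b a w" for w
    using assms
  proof (induction w arbitrary: a b)
    case (Cons i w)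
    have "hp_comp (child b i) (child a i) w = hp_comp (child a i) (child b i) w"
      by (rule Cons.IH) (simp_all add: child_def Cons.prems)
    then show ?case by (simp add: Cons.prems)
  qed (auto simp: max.commute)
qed

text \<open>Multiplying by an expanded identity only eta-expands. Applied to
  \<open>hp_comp w (hp_inv w)\<close>, this makes the natural order preserve all
  permutations.\<close>

lemma perm_hp_comp_id:
  assumes "\<And>w. snd (a w) = id"
  shows "snd (hp_comp a b w) = snd (b w)" "snd (hp_comp b a w) = snd (b w)"
proof -
  have "snd (hp_comp a b w) = snd (b w) \<and> snd (hp_comp b a w) = snd (b w)"
    using assms
  proof (induction w arbitrary: a b)
    case (Cons i w)
    have "\<And>v j. snd (child a j v) = id" unfolding child_def by (rule Cons.prems)
    then have "snd (hp_comp (child a j) (child b i) w) = snd (child b i w)"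
      "snd (hp_comp (child b i) (child a j) w) = snd (child b i w)" for j
      using Cons.IH by blast+
    then show ?case by (simp add: Cons.prems child_apply[of b i w])
  qed auto
  then show "snd (hp_comp a b w) = snd (b w)" "snd (hp_comp b a w) = snd (b w)" by auto
qed

section \<open>Hereditary permutations as terms\<close>

definition lifts :: "nat \<Rightarrow> trm \<Rightarrow> trm" where "lifts n = (\<lambda>t. lift t 0) ^^ n"

lemma lifts_0 [simp]: "lifts 0 t = t"
  by (simp add: lifts_def)

lemma lifts_Suc: "lifts (Suc n) t = lift (lifts n t) 0"
  by (simp add: lifts_def)

lemma lifts_Suc_right: "lifts (Suc n) t = lifts n (lift t 0)"
  by (induction n) (simp_all add: lifts_Suc)

lemma lifts_Var [simp]: "lifts n (Var i) = Var (i + n)"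
  by (induction n) (auto simp: lifts_Suc)

lemma lift_lifts: "lift (lifts n t) (k + n) = lifts n (lift t k)"
  by (induction n) (auto simp: lifts_Suc lift_lift)

lemma subst_lifts: "subst (lifts n t) (lifts n s) (k + n) = lifts n (subst t s k)"
  by (induction n) (auto simp: lifts_Suc lift_subst_ge[symmetric])

lemma subst_lifts_Suc: "subst (lifts (Suc n) t) s n = lifts n t"
proof -
  have "lifts (Suc n) t = lift (lifts n t) n"
    using lift_lifts[of n t 0] by (simp add: lifts_Suc_right)
  then show ?thesis by simp
qed

lemma lift_Abs_pow: "lift ((Abs ^^ n) t) k = (Abs ^^ n) (lift t (k + n))"
  by (induction n arbitrary: k) auto

lemma subst_Abs_pow: "subst ((Abs ^^ n) t) s k = (Abs ^^ n) (subst t (lifts n s) (k + n))"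
  by (induction n arbitrary: s k) (auto simp: lifts_Suc_right)

lemma lift_foldl_App: "lift (foldl App t ts) k = foldl App (lift t k) (map (\<lambda>t. lift t k) ts)"
  by (induction ts arbitrary: t) auto

lemma subst_foldl_App:
  "subst (foldl App t ts) s k = foldl App (subst t s k) (map (\<lambda>t. subst t s k) ts)"
  by (induction ts arbitrary: t) auto

lemma subst_lift_Suc_Var: "subst (lift t (Suc k)) (Var k) k = t"
  by (induction t arbitrary: k) auto

lemma conv_lift: "M \<leftrightarrow>\<^sub>\<beta> N \<Longrightarrow> lift M k \<leftrightarrow>\<^sub>\<beta> lift N k"
proof (induction rule: equivclp_induct)
  case (step P N)
  then have "lift P k \<leftrightarrow>\<^sub>\<beta> lift N k"
    using par_imp_conv[OF par_lift[OF beta_imp_par]] by (blast intro: equivclp_sym)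
  then show ?case by (rule equivclp_trans[OF step.IH])
qed simp

lemma conv_Abs_pow: "M \<leftrightarrow>\<^sub>\<beta> N \<Longrightarrow> (Abs ^^ n) M \<leftrightarrow>\<^sub>\<beta> (Abs ^^ n) N"
  by (induction n) (auto intro: conv_Abs)

lemma conv_foldl_App:
  "M \<leftrightarrow>\<^sub>\<beta> N \<Longrightarrow> list_all2 beta_conv Ms Ns \<Longrightarrow> foldl App M Ms \<leftrightarrow>\<^sub>\<beta> foldl App N Ns"
proof -
  assume "list_all2 beta_conv Ms Ns" "M \<leftrightarrow>\<^sub>\<beta> N"
  then show ?thesis
    by (induction arbitrary: M N rule: list_all2_induct) (auto intro: conv_App)
qed

lemma conv_foldl_App_map:
  "M \<leftrightarrow>\<^sub>\<beta> N \<Longrightarrow> (\<And>i. i \<in> set xs \<Longrightarrow> f i \<leftrightarrow>\<^sub>\<beta> g i) \<Longrightarrow>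
    foldl App M (map f xs) \<leftrightarrow>\<^sub>\<beta> foldl App N (map g xs)"
  by (rule conv_foldl_App) (auto simp: list_all2_conv_all_nth)

text \<open>\<open>ins a N\<close> is the normal form of the hereditary permutation \<open>a\<close> with the term \<open>N\<close> in place of the
  head variable. The recursion is on a depth bound because addresses carry no well-founded order.\<close>

primrec ins_depth :: "nat \<Rightarrow> hp \<Rightarrow> trm \<Rightarrow> trm" where
  "ins_depth 0 a N = N"
| "ins_depth (Suc d) a N = (Abs ^^ arity a) (foldl App (lifts (arity a) N)
     (map (\<lambda>i. ins_depth d (child a i) (Var (arity a - 1 - perm a i))) [0..<arity a]))"

definition ins :: "hp \<Rightarrow> trm \<Rightarrow> trm" where
  "ins a = ins_depth (SOME d. hp_depth d a) a"

lemma ins_depth_one: "ins_depth d hp_one N = N"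
  by (cases d) auto

text \<open>Below a sufficient bound only \<open>hp_one\<close> is left to unfold, and this returns
  the inserted term unchanged. Hence the choice of the bound in \<open>ins\<close> is
  immaterial.\<close>

lemma ins_depth_mono: "hp_depth d a \<Longrightarrow> d \<le> e \<Longrightarrow> ins_depth e a N = ins_depth d a N"
proof (induction d arbitrary: a e N)
  case 0
  then show ?case by (simp add: ins_depth_one)
next
  case (Suc d)
  then obtain e' where e: "e = Suc e'" "d \<le> e'" by (cases e) auto
  have "ins_depth e' (child a i) X = ins_depth d (child a i) X" for i X
    by (rule Suc.IH) (use Suc.prems e in auto)
  then show ?case by (simp add: e)
qed

lemma ins_eq_ins_depth: "hp_depth d a \<Longrightarrow> ins a N = ins_depth d a N"
proof -
  assume d: "hp_depth d a"
  let ?e = "SOME d. hp_depth d a"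
  have e: "hp_depth ?e a" using d by (rule someI)
  have "ins_depth ?e a N = ins_depth (max d ?e) a N"
    by (rule ins_depth_mono[OF e, symmetric]) simp
  also have "\<dots> = ins_depth d a N"
    by (rule ins_depth_mono[OF d]) simp
  finally show ?thesis by (simp add: ins_def)
qed

lemma ins_unfold:
  assumes "a \<in> fhp"
  shows "ins a N = (Abs ^^ arity a) (foldl App (lifts (arity a) N)
     (map (\<lambda>i. ins (child a i) (Var (arity a - 1 - perm a i))) [0..<arity a]))"
proof -
  obtain d where "hp_depth (Suc d) a"
    using assms hp_depth_Suc unfolding fhp_def mem_Collect_eq by metis
  moreover from this have "ins (child a i) X = ins_depth d (child a i) X" for i X
    by (intro ins_eq_ins_depth) auto
  ultimately show ?thesis by (simp add: ins_eq_ins_depth[of "Suc d" a])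
qed

lemma ins_one [simp]: "ins hp_one N = N"
  by (simp add: ins_def ins_depth_one)

text \<open>All variables of \<open>ins a N\<close> outside \<open>N\<close> are bound by its own
  abstractions, so lifting, and likewise substitution, acts on \<open>N\<close> only.\<close>

lemma lift_ins: "a \<in> fhp \<Longrightarrow> lift (ins a N) k = ins a (lift N k)"
proof (induction a arbitrary: N k rule: fhp_induct)
  case (step a)
  show ?case
    unfolding ins_unfold[OF step.hyps]
    by (auto simp: lift_Abs_pow lift_foldl_App lift_lifts step.IH
        intro!: arg_cong[where f = "Abs ^^ _"] arg_cong[where f = "foldl _ _"])
qed simp

lemma subst_ins: "a \<in> fhp \<Longrightarrow> subst (ins a N) s k = ins a (subst N s k)"
proof (induction a arbitrary: N s k rule: fhp_induct)
  case (step a)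
  show ?case
    unfolding ins_unfold[OF step.hyps]
    by (auto simp: subst_Abs_pow subst_foldl_App subst_lifts step.IH
        intro!: arg_cong[where f = "Abs ^^ _"] arg_cong[where f = "foldl _ _"])
qed simp

lemma lifts_ins: "a \<in> fhp \<Longrightarrow> lifts n (ins a N) = ins a (lifts n N)"
  by (induction n) (simp_all add: lifts_Suc lift_ins)

text \<open>The result of applying \<open>ins a N\<close> to the first \<open>q\<close> arguments \<open>As 0, \<dots>, As (q - 1)\<close>.\<close>

definition ins_part :: "nat \<Rightarrow> hp \<Rightarrow> trm \<Rightarrow> (nat \<Rightarrow> trm) \<Rightarrow> trm" where
  "ins_part q a N As = (Abs ^^ (arity a - q)) (foldl App (lifts (arity a - q) N)
     (map (\<lambda>i. ins (child a i) (if perm a i < q then lifts (arity a - q) (As (perm a i))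
        else Var (arity a - 1 - perm a i))) [0..<arity a]))"

lemma perm_less_iff: "a \<in> fhp \<Longrightarrow> perm a i < arity a \<longleftrightarrow> i < arity a"
  using permutes_in_image[OF fhpD(1)] by fastforce

lemma ins_part_Suc:
  assumes a: "a \<in> fhp" and q: "q < arity a"
  shows "App (ins_part q a N As) (As q) \<leftrightarrow>\<^sub>\<beta> ins_part (Suc q) a N As"
proof -
  define r where "r = arity a - Suc q"
  have r: "arity a - q = Suc r" using q by (simp add: r_def)
  let ?X = "\<lambda>i. if perm a i < q then lifts (Suc r) (As (perm a i)) else Var (arity a - 1 - perm a i)"
  let ?B = "foldl App (lifts (Suc r) N) (map (\<lambda>i. ins (child a i) (?X i)) [0..<arity a])"
  \<comment> \<open>The contracted abstraction is the outermost remaining one, so its variable has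
    index \<open>r = arity a - 1 - q\<close> inside; this is the case \<open>perm a i = q\<close>.
    Variables of later positions have smaller indices and stay.\<close>
  have X: "subst (?X i) (lifts r (As q)) r =
      (if perm a i < Suc q then lifts r (As (perm a i)) else Var (arity a - 1 - perm a i))"
    if "i < arity a" for i
  proof -
    have "perm a i < arity a" using that perm_less_iff[OF a] by simp
    then show ?thesis using q by (auto simp: subst_lifts_Suc r_def less_Suc_eq)
  qed
  have 1: "ins_part q a N As = Abs ((Abs ^^ r) ?B)"
    unfolding ins_part_def r by simp
  have "subst ((Abs ^^ r) ?B) (As q) 0 = (Abs ^^ r) (foldl App (lifts r N)
      (map (\<lambda>i. ins (child a i) (subst (?X i) (lifts r (As q)) r)) [0..<arity a]))"
    by (simp add: subst_Abs_pow subst_foldl_App subst_lifts_Suc comp_def subst_ins[OF fhpD(3)[OF a]]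
        del: if_split)
  also have "map (\<lambda>i. ins (child a i) (subst (?X i) (lifts r (As q)) r)) [0..<arity a] =
      map (\<lambda>i. ins (child a i) (if perm a i < Suc q then lifts r (As (perm a i))
        else Var (arity a - 1 - perm a i))) [0..<arity a]"
    using X by (intro map_cong) auto
  finally have 2: "subst ((Abs ^^ r) ?B) (As q) 0 = ins_part (Suc q) a N As"
    unfolding ins_part_def r_def[symmetric] .
  show ?thesis
    unfolding 1 using conv_redex[of "(Abs ^^ r) ?B" "As q"] unfolding 2 .
qed

lemma ins_foldl_part:
  assumes "a \<in> fhp" "q \<le> arity a"
  shows "foldl App (ins a N) (map As [0..<q]) \<leftrightarrow>\<^sub>\<beta> ins_part q a N As"
  using assms(2)
proof (induction q)
  case 0
  then show ?case using ins_unfold[OF assms(1)] by (simp add: ins_part_def)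
next
  case (Suc q)
  then have "App (foldl App (ins a N) (map As [0..<q])) (As q) \<leftrightarrow>\<^sub>\<beta> App (ins_part q a N As) (As q)"
    by (intro conv_App) auto
  also have "\<dots> \<leftrightarrow>\<^sub>\<beta> ins_part (Suc q) a N As"
    using Suc.prems by (intro ins_part_Suc assms(1)) auto
  finally show ?case by simp
qed

text \<open>The identities assumed beyond the arity let the same formula describe surplus arguments:
  they are passed on unchanged.\<close>

lemma ins_foldl_App:
  assumes a: "a \<in> fhp" and p: "arity a \<le> p"
  shows "foldl App (ins a N) (map As [0..<p]) \<leftrightarrow>\<^sub>\<beta>
    foldl App N (map (\<lambda>i. ins (child a i) (As (perm a i))) [0..<p])"
proof -
  let ?m = "arity a"
  let ?f = "\<lambda>i. ins (child a i) (As (perm a i))"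
  have s: "[0..<p] = [0..<?m] @ [?m..<p]"
    using upt_add_eq_append[of 0 ?m "p - ?m"] p by simp
  have map: "map (\<lambda>i. ins (child a i) (if perm a i < ?m then As (perm a i) else Var (?m - 1 - perm a i)))
      [0..<?m] = map ?f [0..<?m]"
    by (rule map_cong) (simp_all add: perm_less_iff[OF a])
  have "ins_part ?m a N As = foldl App N (map ?f [0..<?m])"
    by (simp only: ins_part_def diff_self_eq_0 funpow_0 lifts_0 map)
  then have "foldl App (ins a N) (map As [0..<?m]) \<leftrightarrow>\<^sub>\<beta> foldl App N (map ?f [0..<?m])"
    using ins_foldl_part[OF a, of ?m N As] by simp
  then have "foldl App (ins a N) (map As [0..<p]) \<leftrightarrow>\<^sub>\<beta>
      foldl App (foldl App N (map ?f [0..<?m])) (map As [?m..<p])"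
    unfolding s map_append foldl_append by (rule conv_foldl_App) (simp add: list_all2_same)
  also have "map As [?m..<p] = map ?f [?m..<p]"
    using fhpD(2)[OF a] permutes_not_in[OF fhpD(1)[OF a]] by (intro map_cong) simp_all
  finally show ?thesis unfolding s map_append foldl_append .
qed

text \<open>Applied to a fresh variable, an abstraction contracts back to its body, so eta-expanding
  it is already a beta-conversion.\<close>

lemma eta_conv_Abs:
  assumes "M \<leftrightarrow>\<^sub>\<beta> Abs X"
  shows "M \<leftrightarrow>\<^sub>\<beta> Abs (App (lift M 0) (Var 0))"
proof -
  have "App (lift M 0) (Var 0) \<leftrightarrow>\<^sub>\<beta> App (lift (Abs X) 0) (Var 0)"
    using assms by (intro conv_App conv_lift) auto
  also have "\<dots> \<leftrightarrow>\<^sub>\<beta> X"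
    using conv_redex[of "lift X (Suc 0)" "Var 0"] by (simp add: subst_lift_Suc_Var)
  finally show ?thesis
    using assms by (blast intro: equivclp_trans equivclp_sym conv_Abs)
qed

text \<open>The term \<open>ins a (ins b N)\<close> may be written with arity \<open>p\<close> larger than that of \<open>a\<close> as long as the
  inner term provides enough abstractions; no eta-conversion is needed.\<close>

definition ins_pad :: "nat \<Rightarrow> hp \<Rightarrow> trm \<Rightarrow> trm" where
  "ins_pad p a N = (Abs ^^ p) (foldl App (lifts p N)
     (map (\<lambda>i. ins (child a i) (Var (p - 1 - perm a i))) [0..<p]))"

text \<open>After \<open>p < arity b\<close> arguments the inner term is still an abstraction and
  may be eta-expanded. The new variable is precisely the argument that \<open>a\<close>, continued
  by identities, supplies at position \<open>p\<close>.\<close>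

lemma ins_pad_Suc:
  assumes a: "a \<in> fhp" and b: "b \<in> fhp" and p: "arity a \<le> p" "p < arity b"
  shows "ins_pad p a (ins b N) \<leftrightarrow>\<^sub>\<beta> ins_pad (Suc p) a (ins b N)"
proof -
  let ?As = "\<lambda>p i. ins (child a i) (Var (p - 1 - perm a i))"
  let ?Z = "foldl App (ins b (lifts p N)) (map (?As p) [0..<p])"
  have pm: "perm a i < p" if "i < p" for i
    using permutes_in_image[OF permutes_subset[OF fhpD(1)[OF a], of "{..<p}"]] that p by force
  obtain X where X: "ins_part p b (lifts p N) (?As p) = Abs X"
    using p by (cases "arity b - p") (auto simp: ins_part_def)
  have "?Z \<leftrightarrow>\<^sub>\<beta> Abs X"
    using ins_foldl_part[OF b, of p "lifts p N" "?As p"] p unfolding X by simp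
  then have "?Z \<leftrightarrow>\<^sub>\<beta> Abs (App (lift ?Z 0) (Var 0))"
    using eta_conv_Abs by blast
  also have "App (lift ?Z 0) (Var 0) =
      foldl App (ins b (lifts (Suc p) N)) (map (?As (Suc p)) [0..<Suc p])"
  proof -
    have "lift (?As p i) 0 = ?As (Suc p) i" if "i < p" for i
      using pm[OF that] by (simp add: lift_ins[OF fhpD(3)[OF a]] Suc_diff_Suc)
    moreover have "?As (Suc p) p = Var 0"
      using fhpD(2)[OF a p(1)] permutes_not_in[OF fhpD(1)[OF a], of p] p by simp
    ultimately show ?thesis
      by (auto simp: lift_foldl_App lift_ins[OF b] lifts_Suc intro!: arg_cong[where f = "foldl _ _"])
  qed
  finally show ?thesis
    by (auto simp: ins_pad_def lifts_ins[OF b] funpow_swap1 simp del: upt_Suc intro: conv_Abs_pow)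
qed

lemma ins_pad:
  assumes a: "a \<in> fhp" and b: "b \<in> fhp"
  shows "arity a \<le> p \<Longrightarrow> p \<le> max (arity a) (arity b) \<Longrightarrow>
    ins a (ins b N) \<leftrightarrow>\<^sub>\<beta> ins_pad p a (ins b N)"
proof (induction p rule: dec_induct)
  case base
  then show ?case by (simp add: ins_pad_def ins_unfold[OF a, of "ins b N"])
next
  case (step p)
  then show ?case
    using ins_pad_Suc[OF a b, of p N] by (auto intro: equivclp_trans simp: max_def split: if_splits)
qed

text \<open>Padded to the larger arity, \<open>a\<close> supplies \<open>p\<close> arguments, which
  \<open>b\<close> permutes and wraps into its own children. A child of \<open>b\<close> thus ends
  up outside a child of \<open>a\<close>, which is the reversal built into
  \<open>hp_comp\<close>.\<close>

lemma ins_hp_comp: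
  "a \<in> fhp \<Longrightarrow> b \<in> fhp \<Longrightarrow> ins a (ins b N) \<leftrightarrow>\<^sub>\<beta> ins (hp_comp a b) N"
proof (induction a b arbitrary: N rule: fhp_induct2)
  case (step a b)
  note a = step.hyps(1) and b = step.hyps(2)
  define p where "p = max (arity a) (arity b)"
  let ?As = "\<lambda>i. ins (child a i) (Var (p - 1 - perm a i))"
  have "ins a (ins b N) \<leftrightarrow>\<^sub>\<beta> ins_pad p a (ins b N)"
    by (rule ins_pad[OF a b]) (auto simp: p_def)
  also have "\<dots> = (Abs ^^ p) (foldl App (ins b (lifts p N)) (map ?As [0..<p]))"
    by (simp add: ins_pad_def lifts_ins[OF b])
  also have "\<dots> \<leftrightarrow>\<^sub>\<beta> (Abs ^^ p) (foldl App (lifts p N)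
      (map (\<lambda>i. ins (child b i) (?As (perm b i))) [0..<p]))"
    by (intro conv_Abs_pow ins_foldl_App[OF b]) (simp add: p_def)
  also have "\<dots> \<leftrightarrow>\<^sub>\<beta> (Abs ^^ p) (foldl App (lifts p N)
      (map (\<lambda>i. ins (hp_comp (child b i) (child a (perm b i))) (Var (p - 1 - perm a (perm b i)))) [0..<p]))"
    by (intro conv_Abs_pow conv_foldl_App_map step.IH) auto
  also have "\<dots> = ins (hp_comp a b) N"
    by (simp add: ins_unfold[OF hp_comp_fhp[OF a b]] p_def)
  finally show ?case .
qed simp

definition hp_term :: "hp \<Rightarrow> trm" where "hp_term a = Abs (ins a (Var 0))"

lemma hp_term_one: "hp_term hp_one = comb_I"
  by (simp add: hp_term_def comb_I_def)

lemma lift_hp_term: "a \<in> fhp \<Longrightarrow> lift (hp_term a) k = hp_term a"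
  by (simp add: hp_term_def lift_ins)

lemma App_hp_term: "a \<in> fhp \<Longrightarrow> App (hp_term a) N \<leftrightarrow>\<^sub>\<beta> ins a N"
  unfolding hp_term_def using conv_redex[of "ins a (Var 0)" N] by (simp add: subst_ins)

lemma term_comp_conv: "term_comp M N \<leftrightarrow>\<^sub>\<beta> Abs (App (lift M 0) (App (lift N 0) (Var 0)))"
proof -
  let ?B = "Abs (Abs (App (Var 2) (App (Var 1) (Var 0))))"
  have "term_comp M N \<leftrightarrow>\<^sub>\<beta> App (subst ?B M 0) N"
    unfolding term_comp_def comb_B_def by (intro conv_App conv_redex) auto
  also have "subst ?B M 0 = Abs (Abs (App (lifts 2 M) (App (Var 1) (Var 0))))"
    by (simp add: lifts_Suc numeral_2_eq_2)
  also have "App \<dots> N \<leftrightarrow>\<^sub>\<beta> subst (Abs (App (lifts 2 M) (App (Var 1) (Var 0)))) N 0"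
    by (rule conv_redex)
  also have "\<dots> = Abs (App (lift M 0) (App (lift N 0) (Var 0)))"
    using subst_lifts_Suc[of 1 M "lift N 0"] by (simp add: lifts_Suc numeral_2_eq_2)
  finally show ?thesis .
qed

lemma hp_term_comp:
  assumes a: "a \<in> fhp" and b: "b \<in> fhp"
  shows "term_comp (hp_term a) (hp_term b) \<leftrightarrow>\<^sub>\<beta> hp_term (hp_comp a b)"
proof -
  have "term_comp (hp_term a) (hp_term b) \<leftrightarrow>\<^sub>\<beta> Abs (App (hp_term a) (App (hp_term b) (Var 0)))"
    using term_comp_conv[of "hp_term a" "hp_term b"] by (simp add: lift_hp_term a b)
  also have "\<dots> \<leftrightarrow>\<^sub>\<beta> Abs (App (hp_term a) (ins b (Var 0)))"
    by (intro conv_Abs conv_App App_hp_term b) auto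
  also have "\<dots> \<leftrightarrow>\<^sub>\<beta> Abs (ins a (ins b (Var 0)))"
    by (intro conv_Abs App_hp_term a)
  also have "\<dots> \<leftrightarrow>\<^sub>\<beta> hp_term (hp_comp a b)"
    unfolding hp_term_def by (intro conv_Abs ins_hp_comp a b)
  finally show ?thesis .
qed

section \<open>Finite hereditary permutations\<close>

lemma fhp_induct_arity [consumes 1, case_names step]:
  assumes "a \<in> fhp" "\<And>a. a \<in> fhp \<Longrightarrow> (\<And>i. i < arity a \<Longrightarrow> P (child a i)) \<Longrightarrow> P a"
  shows "P a"
  using assms(1) by (induction a rule: fhp_induct) (auto intro: assms(2))

lemma ins_Var_hnf:
  "a \<in> fhp \<Longrightarrow> ins a (Var x) = hnf (arity a) (x + arity a)
     (map (\<lambda>i. ins (child a i) (Var (arity a - 1 - perm a i))) [0..<arity a])"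
  by (simp add: ins_unfold[of a "Var x"] hnf_def)

text \<open>Translates positions: counting from 1 gives index \<open>n - \<pi> i\<close> for the
  bound variable, counting from 0 gives \<open>n - 1 - p i\<close>.\<close>

lemma HP_at_Node_perm:
  assumes p: "p permutes {..<n}" and Ts: "length Ts = n" "\<And>i. i < n \<Longrightarrow> HP_at (n - 1 - p i) (Ts ! i)"
  shows "HP_at x (Node n (x + n) Ts)"
proof -
  define \<pi> where "\<pi> = (\<lambda>j. if j \<in> {1..n} then Suc (p (inv_into {..<n} Suc j)) else j)"
  have b: "bij_betw Suc {..<n} {1..n}"
    by (auto simp: bij_betw_def lessThan_atLeast0 image_Suc_atLeastLessThan)
  have "\<pi> permutes {1..n}"
    unfolding \<pi>_def by (rule permutes_bij_inv_into[OF p b])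
  moreover have "\<pi> j = Suc (p (j - 1))" if "j \<in> {1..n}" for j
  proof -
    have "inv_into {..<n} Suc (Suc (j - 1)) = j - 1"
      using that by (intro inv_into_f_f) auto
    then show ?thesis using that by (simp add: \<pi>_def)
  qed
  then have "\<forall>j\<in>{1..n}. HP_at (n - \<pi> j) (Ts ! (j - 1))"
    using Ts(2) by (auto simp: Ball_def dest!: spec[of _ "_ - 1"])
  ultimately show ?thesis
    using Ts(1) by (intro HP_at.intros) auto
qed

lemma HP_at_NodeE:
  assumes "HP_at x (Node n k Ts)"
  obtains p where "p permutes {..<n}" "k = x + n" "length Ts = n"
    "\<And>i. i < n \<Longrightarrow> HP_at (n - 1 - p i) (Ts ! i)"
proof -
  from assms obtain \<pi> where \<pi>: "\<pi> permutes {1..n}" "length Ts = n" "k = x + n"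
    "\<forall>i\<in>{1..n}. HP_at (n - \<pi> i) (Ts ! (i - 1))"
    by (auto elim: HP_at.cases)
  define f :: "nat \<Rightarrow> nat" where "f = (\<lambda>j. j - 1)"
  define p where "p = (\<lambda>j. if j \<in> {..<n} then f (\<pi> (inv_into {1..n} f j)) else j)"
  have "bij_betw f {1..n} {..<n}"
    by (rule bij_betw_byWitness[where f' = Suc]) (auto simp: f_def)
  then have p: "p permutes {..<n}"
    unfolding p_def by (rule permutes_bij_inv_into[OF \<pi>(1)])
  have p_eq: "p i = \<pi> (Suc i) - 1" if "i < n" for i
  proof -
    have "inv_into {1..n} f (f (Suc i)) = Suc i"
      using that by (intro inv_into_f_f) (auto simp: f_def inj_on_def)
    then show ?thesis using that by (simp add: p_def f_def)
  qed
  have "HP_at (n - 1 - p i) (Ts ! i)" if "i < n" for i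
  proof -
    have "\<pi> (Suc i) \<in> {1..n}" using permutes_in_image[OF \<pi>(1), of "Suc i"] that by simp
    then have "n - 1 - p i = n - \<pi> (Suc i)" using p_eq[OF that] by simp
    moreover have "HP_at (n - \<pi> (Suc i)) (Ts ! i)"
      using bspec[OF \<pi>(4), of "Suc i"] that by simp
    ultimately show ?thesis by simp
  qed
  then show ?thesis using that p \<pi> by blast
qed

lemma BT_ins:
  "a \<in> fhp \<Longrightarrow> M \<leftrightarrow>\<^sub>\<beta> ins a (Var x) \<Longrightarrow> HP_at x (BT M) \<and> finite_btree (BT M)"
proof (induction a arbitrary: M x rule: fhp_induct_arity)
  case (step a)
  obtain Ms where Ms: "BT M = Node (arity a) (x + arity a) (map BT Ms)"
    "list_all2 beta_conv (map (\<lambda>i. ins (child a i) (Var (arity a - 1 - perm a i))) [0..<arity a]) Ms"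
    using BT_hnf[of M] step.prems unfolding ins_Var_hnf[OF step.hyps] by blast
  have len: "length Ms = arity a"
    using list_all2_lengthD[OF Ms(2)] by simp
  have "Ms ! i \<leftrightarrow>\<^sub>\<beta> ins (child a i) (Var (arity a - 1 - perm a i))" if "i < arity a" for i
    using list_all2_nthD[OF Ms(2), of i] that by (simp add: equivclp_sym)
  then have IH: "HP_at (arity a - 1 - perm a i) (BT (Ms ! i)) \<and> finite_btree (BT (Ms ! i))"
    if "i < arity a" for i
    using step.IH that by blast
  have "HP_at x (BT M)"
    unfolding Ms(1) by (rule HP_at_Node_perm[OF fhpD(1)[OF step.hyps]]) (use IH len in auto)
  moreover have "finite_btree (BT M)"
    unfolding Ms(1) using IH len by (intro finite_btree.intros) (auto simp: in_set_conv_nth)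
  ultimately show ?case by blast
qed

definition hp_node :: "nat \<Rightarrow> (nat \<Rightarrow> nat) \<Rightarrow> (nat \<Rightarrow> hp) \<Rightarrow> hp" where
  "hp_node n p c w = (case w of [] \<Rightarrow> (n, p) | i # v \<Rightarrow> if i < n then c i v else (0, id))"

lemma hp_node_Nil [simp]: "hp_node n p c [] = (n, p)"
  by (simp add: hp_node_def)

lemma child_hp_node: "child (hp_node n p c) i = (if i < n then c i else hp_one)"
  by (auto simp: child_def hp_node_def hp_one_def)

text \<open>A single level of the passage from trees back to terms, kept apart from the induction
  because the root of a term in \<open>FHP\<close> has an additional abstraction and is treated
  separately.\<close>

lemma hnf_conv_ins:
  assumes HP: "HP_at x (Node n k (map BT Ms))"
    and IH: "\<And>M y. M \<in> set Ms \<Longrightarrow> HP_at y (BT M) \<Longrightarrow> \<exists>a\<in>fhp. M \<leftrightarrow>\<^sub>\<beta> ins a (Var y)"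
  shows "\<exists>a\<in>fhp. hnf n k Ms \<leftrightarrow>\<^sub>\<beta> ins a (Var x)"
proof -
  from HP obtain p where p: "p permutes {..<n}" "k = x + n" "length Ms = n"
    "\<And>i. i < n \<Longrightarrow> HP_at (n - 1 - p i) (map BT Ms ! i)"
    by (rule HP_at_NodeE) auto
  have "\<exists>a\<in>fhp. Ms ! i \<leftrightarrow>\<^sub>\<beta> ins a (Var (n - 1 - p i))" if "i < n" for i
    using p(3,4) that by (intro IH) auto
  then obtain c where c: "\<And>i. i < n \<Longrightarrow> c i \<in> fhp \<and> Ms ! i \<leftrightarrow>\<^sub>\<beta> ins (c i) (Var (n - 1 - p i))"
    by metis
  let ?a = "hp_node n p c"
  have a: "?a \<in> fhp"
    by (rule fhpI) (use p(1) c in \<open>simp_all add: child_hp_node\<close>)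
  have "hnf n k Ms = (Abs ^^ n) (foldl App (Var k) (map ((!) Ms) [0..<n]))"
    using p(3) map_nth[of Ms] by (simp add: hnf_def)
  also have "\<dots> \<leftrightarrow>\<^sub>\<beta> (Abs ^^ n) (foldl App (Var k)
      (map (\<lambda>i. ins (child ?a i) (Var (n - 1 - p i))) [0..<n]))"
    using c by (intro conv_Abs_pow conv_foldl_App_map) (auto simp: child_hp_node)
  also have "\<dots> = ins ?a (Var x)"
    using ins_Var_hnf[OF a, of x] by (simp add: hnf_def p(2))
  finally show ?thesis using a by blast
qed

lemma BT_imp_ins:
  "finite_btree T \<Longrightarrow> HP_at x T \<Longrightarrow> BT M = T \<Longrightarrow> \<exists>a\<in>fhp. M \<leftrightarrow>\<^sub>\<beta> ins a (Var x)"
proof (induction T arbitrary: x M rule: finite_btree.induct)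
  case 1
  then show ?case by (auto elim: HP_at.cases)
next
  case (2 Ts n k)
  obtain Ms where Ms: "M \<leftrightarrow>\<^sub>\<beta> hnf n k Ms" "Ts = map BT Ms"
    using BT_Node_imp_conv[OF 2(4)] by blast
  obtain a where "a \<in> fhp" "hnf n k Ms \<leftrightarrow>\<^sub>\<beta> ins a (Var x)"
    using hnf_conv_ins[OF 2(3)[unfolded Ms(2)]] 2(2)[OF _ _ refl] unfolding Ms(2) by auto
  then show ?case using Ms(1) by (blast intro: equivclp_trans)
qed

lemma FHP_iff: "M \<in> FHP \<longleftrightarrow> (\<exists>a\<in>fhp. M \<leftrightarrow>\<^sub>\<beta> hp_term a)"
proof
  assume "M \<in> FHP"
  then obtain T where T: "BT M = abs_btree T" "HP_at 0 T" "finite_btree (BT M)"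
    by (auto simp: FHP_def HP_def)
  then obtain n k Ts where Node: "T = Node n k Ts"
    by (cases T) (auto elim: HP_at.cases)
  then obtain Ms where Ms: "M \<leftrightarrow>\<^sub>\<beta> hnf (Suc n) k Ms" "Ts = map BT Ms"
    using BT_Node_imp_conv[of M "Suc n" k Ts] T(1) by auto
  have fin: "finite_btree (BT N)" if "N \<in> set Ms" for N
    using T(1,3) that unfolding Node Ms(2) by (auto elim: finite_btree.cases)
  obtain a where a: "a \<in> fhp" "hnf n k Ms \<leftrightarrow>\<^sub>\<beta> ins a (Var 0)"
    using hnf_conv_ins[OF T(2)[unfolded Node Ms(2)]] BT_imp_ins[OF fin _ refl] by blast
  have "hnf (Suc n) k Ms \<leftrightarrow>\<^sub>\<beta> hp_term a"
    using conv_Abs[OF a(2)] by (simp add: hnf_def hp_term_def)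
  then show "\<exists>a\<in>fhp. M \<leftrightarrow>\<^sub>\<beta> hp_term a"
    using a(1) Ms(1) by (blast intro: equivclp_trans)
next
  assume "\<exists>a\<in>fhp. M \<leftrightarrow>\<^sub>\<beta> hp_term a"
  then obtain a where a: "a \<in> fhp" and M: "M \<leftrightarrow>\<^sub>\<beta> hp_term a" by blast
  let ?Cs = "map (\<lambda>i. ins (child a i) (Var (arity a - 1 - perm a i))) [0..<arity a]"
  \<comment> \<open>The additional abstraction binds the head variable itself, whose index is
    therefore the number of the remaining abstractions.\<close>
  have "hp_term a = hnf (Suc (arity a)) (arity a) ?Cs"
    by (simp add: hp_term_def ins_Var_hnf[OF a] hnf_def)
  with M have "M \<leftrightarrow>\<^sub>\<beta> hnf (Suc (arity a)) (arity a) ?Cs" by (simp only:)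
  from BT_hnf[OF this] obtain Ms where Ms: "BT M = Node (Suc (arity a)) (arity a) (map BT Ms)"
    "list_all2 beta_conv ?Cs Ms"
    by blast
  have len: "length Ms = arity a"
    using list_all2_lengthD[OF Ms(2)] by simp
  have "Ms ! i \<leftrightarrow>\<^sub>\<beta> ins (child a i) (Var (arity a - 1 - perm a i))" if "i < arity a" for i
    using list_all2_nthD[OF Ms(2), of i] that by (simp add: equivclp_sym)
  then have BT: "HP_at (arity a - 1 - perm a i) (BT (Ms ! i)) \<and> finite_btree (BT (Ms ! i))"
    if "i < arity a" for i
    using BT_ins[OF fhpD(3)[OF a]] that by blast
  have "HP_at 0 (Node (arity a) (0 + arity a) (map BT Ms))"
    by (rule HP_at_Node_perm[OF fhpD(1)[OF a]]) (use BT len in auto)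
  then have "BT M \<in> HP"
    unfolding HP_def Ms(1) by (auto intro!: exI[of _ "Node (arity a) (arity a) (map BT Ms)"])
  moreover have "finite_btree (BT M)"
    unfolding Ms(1) using BT len by (intro finite_btree.intros) (auto simp: in_set_conv_nth)
  ultimately show "M \<in> FHP" by (simp add: FHP_def)
qed

section \<open>Separation\<close>

lemma lambda_theoryD:
  assumes "lambda_theory T"
  shows theory_refl: "(M, M) \<in> T"
    and theory_trans: "(M, N) \<in> T \<Longrightarrow> (N, P) \<in> T \<Longrightarrow> (M, P) \<in> T"
    and theory_conv: "M \<leftrightarrow>\<^sub>\<beta> N \<Longrightarrow> (M, N) \<in> T"
    and theory_App: "(M, M') \<in> T \<Longrightarrow> (N, N') \<in> T \<Longrightarrow> (App M N, App M' N') \<in> T"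
    and theory_Abs: "(M, N) \<in> T \<Longrightarrow> (Abs M, Abs N) \<in> T"
  using assms unfolding lambda_theory_def equiv_def
  by (auto elim: refl_onD symE transE)

lemma theory_foldl_App:
  "lambda_theory T \<Longrightarrow> (M, N) \<in> T \<Longrightarrow> (foldl App M Xs, foldl App N Xs) \<in> T"
  by (induction Xs arbitrary: M N) (auto intro: theory_App theory_refl)

lemma theory_conv2:
  assumes T: "lambda_theory T" and MN: "(M, N) \<in> T" and "M \<leftrightarrow>\<^sub>\<beta> M'" "N \<leftrightarrow>\<^sub>\<beta> N'"
  shows "(M', N') \<in> T"
  using theory_trans[OF T theory_conv[OF T equivclp_sym[OF assms(3)]]
    theory_trans[OF T MN theory_conv[OF T assms(4)]]] .

definition eraser :: "nat \<Rightarrow> trm \<Rightarrow> trm" where "eraser q X = (Abs ^^ q) (lifts q X)"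

lemma eraser_foldl: "foldl App (eraser (length Ys) X) Ys \<leftrightarrow>\<^sub>\<beta> X"
proof (induction Ys)
  case Nil
  then show ?case by (simp add: eraser_def)
next
  case (Cons Y Ys)
  let ?q = "length Ys"
  have "subst ((Abs ^^ ?q) (lifts (Suc ?q) X)) Y 0 = eraser ?q X"
    by (simp add: subst_Abs_pow subst_lifts_Suc eraser_def)
  then have "App (eraser (Suc ?q) X) Y \<leftrightarrow>\<^sub>\<beta> eraser ?q X"
    using conv_redex[of "(Abs ^^ ?q) (lifts (Suc ?q) X)" Y] by (simp add: eraser_def)
  then have "foldl App (App (eraser (Suc ?q) X) Y) Ys \<leftrightarrow>\<^sub>\<beta> foldl App (eraser ?q X) Ys"
    by (rule conv_foldl_App) (simp add: list_all2_same)
  then show ?case using Cons.IH by (auto intro: equivclp_trans)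
qed

lemma projection_exists:
  assumes "j < p"
  shows "\<exists>P. \<forall>Xs. length Xs = p \<longrightarrow> foldl App P Xs \<leftrightarrow>\<^sub>\<beta> Xs ! j"
proof (intro exI allI impI)
  fix Xs :: "trm list" assume len: "length Xs = p"
  \<comment> \<open>The witness erases the \<open>j\<close> arguments before the wanted one, takes
    that one, and then erases the \<open>r\<close> arguments behind it.\<close>
  define r where "r = p - 1 - j"
  let ?S = "Abs (eraser r (Var 0))"
  have Xs: "Xs = take j Xs @ Xs ! j # drop (Suc j) Xs"
    using assms len by (intro id_take_nth_drop) simp
  have tk: "length (take j Xs) = j" and dr: "length (drop (Suc j) Xs) = r"
    using assms len by (auto simp: r_def)
  have "subst (eraser r (Var 0)) (Xs ! j) 0 = eraser r (Xs ! j)"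
    using subst_lifts[of r "Var 0" "Xs ! j" 0] by (simp add: eraser_def subst_Abs_pow)
  then have 1: "App ?S (Xs ! j) \<leftrightarrow>\<^sub>\<beta> eraser r (Xs ! j)"
    using conv_redex[of "eraser r (Var 0)" "Xs ! j"] by simp
  have "foldl App (eraser j ?S) (take j Xs) \<leftrightarrow>\<^sub>\<beta> ?S"
    using eraser_foldl[of "take j Xs" ?S] unfolding tk .
  then have "App (foldl App (eraser j ?S) (take j Xs)) (Xs ! j) \<leftrightarrow>\<^sub>\<beta> App ?S (Xs ! j)"
    by (rule conv_App) simp
  then have "App (foldl App (eraser j ?S) (take j Xs)) (Xs ! j) \<leftrightarrow>\<^sub>\<beta> eraser r (Xs ! j)"
    using 1 by (rule equivclp_trans)
  then have "foldl App (App (foldl App (eraser j ?S) (take j Xs)) (Xs ! j)) (drop (Suc j) Xs) \<leftrightarrow>\<^sub>\<beta>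
      foldl App (eraser r (Xs ! j)) (drop (Suc j) Xs)"
    by (rule conv_foldl_App) (simp add: list_all2_same)
  also have "foldl App (eraser r (Xs ! j)) (drop (Suc j) Xs) \<leftrightarrow>\<^sub>\<beta> Xs ! j"
    using eraser_foldl[of "drop (Suc j) Xs"] unfolding dr .
  finally have "foldl App (eraser j ?S) (take j Xs @ Xs ! j # drop (Suc j) Xs) \<leftrightarrow>\<^sub>\<beta> Xs ! j"
    by simp
  then show "foldl App (eraser j (Abs (eraser (p - 1 - j) (Var 0)))) Xs \<leftrightarrow>\<^sub>\<beta> Xs ! j"
    using Xs unfolding r_def by simp
qed

text \<open>Put the projection to \<open>j\<close> in head position and supply as many arguments as
  the larger arity, so that both terms use up their abstractions. The family \<open>As\<close> stays
  free: one choice exposes different permutations, another one yields the equation between the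
  children.\<close>

lemma theory_children:
  assumes T: "lambda_theory T" and a: "a \<in> fhp" and b: "b \<in> fhp"
    and ab: "(hp_term a, hp_term b) \<in> T" and j: "j < max (arity a) (arity b)"
  shows "(ins (child a j) (As (perm a j)), ins (child b j) (As (perm b j))) \<in> T"
proof -
  define p where "p = max (arity a) (arity b)"
  obtain P where P: "\<And>Xs. length Xs = p \<Longrightarrow> foldl App P Xs \<leftrightarrow>\<^sub>\<beta> Xs ! j"
    using projection_exists j unfolding p_def by blast
  have red: "foldl App (App (hp_term c) P) (map As [0..<p]) \<leftrightarrow>\<^sub>\<beta> ins (child c j) (As (perm c j))"
    if c: "c \<in> fhp" "arity c \<le> p" for c
  proof -
    let ?Xs = "map (\<lambda>i. ins (child c i) (As (perm c i))) [0..<p]"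
    have "foldl App (App (hp_term c) P) (map As [0..<p]) \<leftrightarrow>\<^sub>\<beta> foldl App (ins c P) (map As [0..<p])"
      by (rule conv_foldl_App[OF App_hp_term[OF c(1)]]) (simp add: list_all2_same)
    also have "foldl App (ins c P) (map As [0..<p]) \<leftrightarrow>\<^sub>\<beta> foldl App P ?Xs"
      by (rule ins_foldl_App[OF c])
    also have "foldl App P ?Xs \<leftrightarrow>\<^sub>\<beta> ?Xs ! j"
      by (rule P) simp
    finally show ?thesis using j unfolding p_def by simp
  qed
  have "(foldl App (App (hp_term a) P) (map As [0..<p]), foldl App (App (hp_term b) P) (map As [0..<p])) \<in> T"
    by (intro theory_foldl_App theory_App theory_refl T ab)
  then show ?thesis
    by (rule theory_conv2[OF T]) (rule red; simp add: a b p_def)+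
qed

text \<open>A special case of Boehm's theorem. If the permutations of two nodes differ at \<open>j\<close>, plug in the
  \<open>j\<close>-th projection for the head variable and erasers for the arguments.\<close>

lemma theory_separation:
  assumes T: "lambda_theory T" and consistent: "T \<noteq> UNIV"
    and "a \<in> fhp" "b \<in> fhp" "(hp_term a, hp_term b) \<in> T"
  shows "snd (a w) = snd (b w)"
proof -
  have node: "perm a j = perm b j \<and> (hp_term (child a j), hp_term (child b j)) \<in> T"
    if a: "a \<in> fhp" and b: "b \<in> fhp" and ab: "(hp_term a, hp_term b) \<in> T" for a b j
  proof (cases "j < max (arity a) (arity b)")
    case False
    then show ?thesis
      using fhpD(2)[OF a, of j] fhpD(2)[OF b, of j] theory_refl[OF T]
        permutes_not_in[OF fhpD(1)[OF a], of j] permutes_not_in[OF fhpD(1)[OF b], of j]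
      by (auto simp: less_max_iff_disj)
  next
    case True
    note ins = theory_children[OF T a b ab True]
    have "perm a j = perm b j"
    proof (rule ccontr)
      assume neq: "perm a j \<noteq> perm b j"
      have "(M, N) \<in> T" for M N
      proof -
        \<comment> \<open>With \<open>q\<close> dummy arguments both children expose the eraser at
          their head, which discards everything else. What remains is \<open>M\<close> on the left
          and \<open>N\<close> on the right, as the two positions differ.\<close>
        define q where "q = max (arity (child a j)) (arity (child b j))"
        define As where "As = (\<lambda>i. eraser q (if i = perm a j then M else N))"
        have red: "foldl App (ins c (eraser q X)) (map (\<lambda>_. Var 0) [0..<q]) \<leftrightarrow>\<^sub>\<beta> X"
          if "c \<in> fhp" "arity c \<le> q" for c X
          using equivclp_trans[OF ins_foldl_App[OF that, of "eraser q X" "\<lambda>_. Var 0"]]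
            eraser_foldl[of "map (\<lambda>i. ins (child c i) (Var 0)) [0..<q]" X] by simp
        have "(foldl App (ins (child a j) (As (perm a j))) (map (\<lambda>_. Var 0) [0..<q]),
            foldl App (ins (child b j) (As (perm b j))) (map (\<lambda>_. Var 0) [0..<q])) \<in> T"
          by (intro theory_foldl_App T ins)
        then show ?thesis
          by (rule theory_conv2[OF T]) (use neq red fhpD(3)[OF a] fhpD(3)[OF b] in \<open>simp_all add: As_def q_def\<close>)
      qed
      then show False using consistent by auto
    qed
    \<comment> \<open>Giving all arguments as the same variable and abstracting it makes closed
      terms of the two children, ready for the descent along the address.\<close>
    then show ?thesis
      using ins[of "\<lambda>_. Var 0"] by (auto simp: hp_term_def intro: theory_Abs[OF T])
  qed
  show ?thesis
    using assms(3-5)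
  proof (induction w arbitrary: a b)
    case Nil
    then show ?case using node by (auto simp: fun_eq_iff)
  next
    case (Cons i w)
    then have "snd (child a i w) = snd (child b i w)"
      using node by (intro Cons.IH fhpD(3)) auto
    then show ?case by (simp add: child_apply)
  qed
qed

section \<open>Quotients of inverse monoids\<close>

lemma inverse_monoidD:
  assumes "inverse_monoid S star"
  shows "monoid S"
    and "u \<in> carrier S \<Longrightarrow> star u \<in> carrier S"
    and "u \<in> carrier S \<Longrightarrow> star (star u) = u"
    and "u \<in> carrier S \<Longrightarrow> v \<in> carrier S \<Longrightarrow> star (u \<otimes>\<^bsub>S\<^esub> v) = star v \<otimes>\<^bsub>S\<^esub> star u"
    and "u \<in> carrier S \<Longrightarrow> u \<otimes>\<^bsub>S\<^esub> star u \<otimes>\<^bsub>S\<^esub> u = u"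
    and "u \<in> carrier S \<Longrightarrow> v \<in> carrier S \<Longrightarrow>
      (u \<otimes>\<^bsub>S\<^esub> star u) \<otimes>\<^bsub>S\<^esub> (v \<otimes>\<^bsub>S\<^esub> star v) = (v \<otimes>\<^bsub>S\<^esub> star v) \<otimes>\<^bsub>S\<^esub> (u \<otimes>\<^bsub>S\<^esub> star u)"
  using assms unfolding inverse_monoid_def by blast+

lemma natural_le_antisym:
  assumes S: "inverse_monoid S star" and u: "u \<in> carrier S" and v: "v \<in> carrier S"
    and uv: "natural_le S star u v" and vu: "natural_le S star v u"
  shows "u = v"
proof -
  interpret monoid S by (rule inverse_monoidD(1)[OF S])
  note [simp] = inverse_monoidD(2)[OF S]
  let ?e = "u \<otimes>\<^bsub>S\<^esub> star u" and ?f = "v \<otimes>\<^bsub>S\<^esub> star v"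
  have ev: "?e \<otimes>\<^bsub>S\<^esub> v = u" and fu: "?f \<otimes>\<^bsub>S\<^esub> u = v"
    using uv vu by (simp_all add: natural_le_def)
  have "u = ?e \<otimes>\<^bsub>S\<^esub> (?f \<otimes>\<^bsub>S\<^esub> u)" using ev fu by simp
  also have "\<dots> = (?f \<otimes>\<^bsub>S\<^esub> ?e) \<otimes>\<^bsub>S\<^esub> u"
    using inverse_monoidD(6)[OF S u v] u v by (simp add: m_assoc[symmetric])
  also have "\<dots> = ?f \<otimes>\<^bsub>S\<^esub> (?e \<otimes>\<^bsub>S\<^esub> u)"
    using u v by (intro m_assoc) auto
  also have "\<dots> = v" using fu inverse_monoidD(5)[OF S u] by simp
  finally show ?thesis .
qed

text \<open>Uniqueness of inverses, from the commutation of just those idempotents that the two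
  candidates produce. It serves to carry the star over to a quotient.\<close>

lemma (in monoid) inverse_unique_if_commute:
  assumes c: "a \<in> carrier G" "x \<in> carrier G" "y \<in> carrier G"
    and x: "a \<otimes> x \<otimes> a = a" "x \<otimes> a \<otimes> x = x"
    and y: "a \<otimes> y \<otimes> a = a" "y \<otimes> a \<otimes> y = y"
    and comm: "(a \<otimes> x) \<otimes> (a \<otimes> y) = (a \<otimes> y) \<otimes> (a \<otimes> x)"
      "(x \<otimes> a) \<otimes> (y \<otimes> a) = (y \<otimes> a) \<otimes> (x \<otimes> a)"
  shows "x = y"
proof -
  have "x = x \<otimes> (a \<otimes> y \<otimes> a) \<otimes> x" using x y by simp
  also have "\<dots> = ((x \<otimes> a) \<otimes> (y \<otimes> a)) \<otimes> x" using c by (simp add: m_assoc)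
  also have "\<dots> = y \<otimes> a \<otimes> (x \<otimes> a \<otimes> x)" unfolding comm using c by (simp add: m_assoc)
  also have "\<dots> = (y \<otimes> a \<otimes> y) \<otimes> a \<otimes> x" using x y by simp
  also have "\<dots> = y \<otimes> ((a \<otimes> x) \<otimes> (a \<otimes> y))" unfolding comm using c by (simp add: m_assoc)
  also have "\<dots> = y \<otimes> (a \<otimes> x \<otimes> a) \<otimes> y" using c by (simp add: m_assoc)
  also have "\<dots> = y" using x y by simp
  finally show ?thesis .
qed

lemma inverse_monoid_image:
  assumes S: "inverse_monoid S star"
    and image: "f ` carrier S = carrier Q"
    and mult: "\<And>x y. x \<in> carrier S \<Longrightarrow> y \<in> carrier S \<Longrightarrow> f (x \<otimes>\<^bsub>S\<^esub> y) = f x \<otimes>\<^bsub>Q\<^esub> f y"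
    and one: "f \<one>\<^bsub>S\<^esub> = \<one>\<^bsub>Q\<^esub>"
  obtains star' where "inverse_monoid Q star'" "\<And>x. x \<in> carrier S \<Longrightarrow> star' (f x) = f (star x)"
proof -
  interpret S: monoid S by (rule inverse_monoidD(1)[OF S])
  note SD = inverse_monoidD[OF S]
  have closed: "f x \<in> carrier Q" if "x \<in> carrier S" for x
    unfolding image[symmetric] using that by (rule imageI)
  have pre: "\<exists>x\<in>carrier S. y = f x" if "y \<in> carrier Q" for y
    using that unfolding image[symmetric] image_iff .
  have Q: "monoid Q"
  proof (rule monoidI)
    show "\<one>\<^bsub>Q\<^esub> \<in> carrier Q" using closed[OF S.one_closed] one by simp
    show "x \<otimes>\<^bsub>Q\<^esub> y \<in> carrier Q" if xy: "x \<in> carrier Q" "y \<in> carrier Q" for x y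
    proof -
      obtain x' y' where "x' \<in> carrier S" "y' \<in> carrier S" "x = f x'" "y = f y'"
        using pre[OF xy(1)] pre[OF xy(2)] by blast
      then show ?thesis using closed[of "x' \<otimes>\<^bsub>S\<^esub> y'"] by (simp add: mult)
    qed
    show "x \<otimes>\<^bsub>Q\<^esub> y \<otimes>\<^bsub>Q\<^esub> z = x \<otimes>\<^bsub>Q\<^esub> (y \<otimes>\<^bsub>Q\<^esub> z)"
      if xyz: "x \<in> carrier Q" "y \<in> carrier Q" "z \<in> carrier Q" for x y z
    proof -
      obtain x' y' z' where "x' \<in> carrier S" "y' \<in> carrier S" "z' \<in> carrier S"
        "x = f x'" "y = f y'" "z = f z'"
        using pre[OF xyz(1)] pre[OF xyz(2)] pre[OF xyz(3)] by blast
      then show ?thesis by (simp flip: mult add: S.m_assoc)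
    qed
    show "\<one>\<^bsub>Q\<^esub> \<otimes>\<^bsub>Q\<^esub> x = x" "x \<otimes>\<^bsub>Q\<^esub> \<one>\<^bsub>Q\<^esub> = x" if x: "x \<in> carrier Q" for x
    proof -
      obtain x' where "x' \<in> carrier S" "x = f x'"
        using pre[OF x] by blast
      then show "\<one>\<^bsub>Q\<^esub> \<otimes>\<^bsub>Q\<^esub> x = x" "x \<otimes>\<^bsub>Q\<^esub> \<one>\<^bsub>Q\<^esub> = x"
        by (simp_all flip: mult one)
    qed
  qed
  interpret Q: monoid Q by (rule Q)
  \<comment> \<open>Only here is there something to prove about the star of a quotient:
    \<open>f (star s)\<close> and \<open>f (star t)\<close> are inverses of the same element, and
    the idempotents involved are images of commuting ones.\<close>
  have star_cong: "f (star s) = f (star t)"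
    if s: "s \<in> carrier S" and t: "t \<in> carrier S" and st: "f s = f t" for s t
  proof -
    have [simp]: "star s \<in> carrier S" "star t \<in> carrier S" using s t SD(2) by auto
    have comm: "f (u \<otimes>\<^bsub>S\<^esub> star u) \<otimes>\<^bsub>Q\<^esub> f (v \<otimes>\<^bsub>S\<^esub> star v) = f (v \<otimes>\<^bsub>S\<^esub> star v) \<otimes>\<^bsub>Q\<^esub> f (u \<otimes>\<^bsub>S\<^esub> star u)"
      if "u \<in> carrier S" "v \<in> carrier S" for u v
      using SD(6)[OF that] that SD(2) by (simp flip: mult)
    show ?thesis
    proof (rule Q.inverse_unique_if_commute)
      show "f s \<in> carrier Q" "f (star s) \<in> carrier Q" "f (star t) \<in> carrier Q"
        using s by (auto intro: closed)
      show "f s \<otimes>\<^bsub>Q\<^esub> f (star s) \<otimes>\<^bsub>Q\<^esub> f s = f s"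
        using s SD(5)[OF s] by (simp flip: mult)
      show "f (star s) \<otimes>\<^bsub>Q\<^esub> f s \<otimes>\<^bsub>Q\<^esub> f (star s) = f (star s)"
        using s SD(3)[OF s] SD(5)[of "star s"] by (simp flip: mult)
      show "f s \<otimes>\<^bsub>Q\<^esub> f (star t) \<otimes>\<^bsub>Q\<^esub> f s = f s"
        unfolding st using t SD(5)[OF t] by (simp flip: mult)
      show "f (star t) \<otimes>\<^bsub>Q\<^esub> f s \<otimes>\<^bsub>Q\<^esub> f (star t) = f (star t)"
        unfolding st using t SD(3)[OF t] SD(5)[of "star t"] by (simp flip: mult)
      show "(f s \<otimes>\<^bsub>Q\<^esub> f (star s)) \<otimes>\<^bsub>Q\<^esub> (f s \<otimes>\<^bsub>Q\<^esub> f (star t)) =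
          (f s \<otimes>\<^bsub>Q\<^esub> f (star t)) \<otimes>\<^bsub>Q\<^esub> (f s \<otimes>\<^bsub>Q\<^esub> f (star s))"
        using comm[OF s t] mult[of s "star s"] mult[of t "star t"] s t st by simp
      show "(f (star s) \<otimes>\<^bsub>Q\<^esub> f s) \<otimes>\<^bsub>Q\<^esub> (f (star t) \<otimes>\<^bsub>Q\<^esub> f s) =
          (f (star t) \<otimes>\<^bsub>Q\<^esub> f s) \<otimes>\<^bsub>Q\<^esub> (f (star s) \<otimes>\<^bsub>Q\<^esub> f s)"
        using comm[of "star s" "star t"] mult[of "star s" s] mult[of "star t" t] s t st SD(3) by simp
    qed
  qed
  define star' where "star' y = f (star (SOME x. x \<in> carrier S \<and> f x = y))" for y
  have star': "star' (f x) = f (star x)" if "x \<in> carrier S" for x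
  proof -
    have "(SOME z. z \<in> carrier S \<and> f z = f x) \<in> carrier S \<and> f (SOME z. z \<in> carrier S \<and> f z = f x) = f x"
      by (rule someI[of _ x]) (use that in simp)
    then show ?thesis unfolding star'_def using that by (intro star_cong) auto
  qed
  have "inverse_monoid Q star'"
    unfolding inverse_monoid_def image[symmetric]
    using Q SD(2-6) by (auto simp: star' mult[symmetric] intro!: imageI)
  then show ?thesis using star' that by blast
qed

section \<open>The F-inverse monoid\<close>

definition hp_monoid :: "hp monoid" where
  "hp_monoid = \<lparr>carrier = fhp, monoid.mult = hp_comp, one = hp_one\<rparr>"

lemma hp_monoid_simps [simp]:
  "carrier hp_monoid = fhp" "x \<otimes>\<^bsub>hp_monoid\<^esub> y = hp_comp x y" "\<one>\<^bsub>hp_monoid\<^esub> = hp_one"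
  by (simp_all add: hp_monoid_def)

lemma hp_inverse_monoid: "inverse_monoid hp_monoid hp_inv"
  unfolding inverse_monoid_def
proof (intro conjI ballI)
  show "monoid hp_monoid"
    by (rule monoidI) (simp_all add: hp_comp_fhp hp_comp_assoc)
qed (auto simp: hp_inv_fhp hp_inv_inv hp_inv_comp hp_comp_inv
      intro: hp_comp_commute perm_hp_comp_inv)

theorem theorem4p12:
  fixes T :: "(trm \<times> trm) set"
  assumes "lambda_theory T"
  shows "submonoid (FHP // T) (term_quot T) \<and>
         (\<exists>star. F_inverse_monoid (term_quot T\<lparr>carrier := FHP // T\<rparr>) star)"
proof
  note T = assms
  have equiv: "equiv UNIV T" using T by (simp add: lambda_theory_def)
  let ?Q = "term_quot T\<lparr>carrier := FHP // T\<rparr>"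
  define f where "f a = T `` {hp_term a}" for a
  have f_eq: "f a = f b \<longleftrightarrow> (hp_term a, hp_term b) \<in> T" for a b
    using equiv by (simp add: f_def eq_equiv_class_iff)
  have T_class: "T `` {M} = T `` {N}" if "M \<leftrightarrow>\<^sub>\<beta> N" for M N
    using equiv theory_conv[OF T that] by (rule equiv_class_eq)
  have image: "f ` fhp = FHP // T"
  proof (intro equalityI subsetI)
    fix X assume "X \<in> FHP // T"
    then obtain M where "M \<in> FHP" "X = T `` {M}" by (auto elim: quotientE)
    then show "X \<in> f ` fhp" using T_class by (auto simp: FHP_iff f_def)
  next
    fix X assume "X \<in> f ` fhp"
    then obtain a where a: "a \<in> fhp" "X = T `` {hp_term a}" by (auto simp: f_def)
    have "hp_term a \<in> FHP" unfolding FHP_iff by (rule bexI[of _ a]) (simp_all add: a(1))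
    with a(2) show "X \<in> FHP // T" by (auto intro!: quotientI)
  qed
  have mult: "f (hp_comp a b) = f a \<otimes>\<^bsub>term_quot T\<^esub> f b" if "a \<in> fhp" "b \<in> fhp" for a b
  proof -
    \<comment> \<open>The union in \<open>term_quot\<close> runs over all representatives;
      compatibility with application makes all its members the same class.\<close>
    have "T `` {term_comp M N} = f (hp_comp a b)" if "M \<in> f a" "N \<in> f b" for M N
    proof -
      have "(term_comp (hp_term a) (hp_term b), term_comp M N) \<in> T"
        using that unfolding term_comp_def f_def by (auto intro!: theory_App[OF T] theory_refl[OF T])
      then have "T `` {term_comp M N} = T `` {term_comp (hp_term a) (hp_term b)}"
        using equiv by (metis equiv_class_eq)
      also have "\<dots> = f (hp_comp a b)"
        unfolding f_def by (rule T_class[OF hp_term_comp]) fact+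
      finally show ?thesis .
    qed
    moreover have "hp_term a \<in> f a" "hp_term b \<in> f b"
      by (simp_all add: f_def theory_refl[OF T])
    ultimately show ?thesis
      unfolding term_quot_def monoid.simps by (auto 4 4)
  qed
  have one: "f hp_one = \<one>\<^bsub>term_quot T\<^esub>"
    by (simp add: f_def hp_term_one term_quot_def)
  show "submonoid (FHP // T) (term_quot T)"
  proof
    show "FHP // T \<subseteq> carrier (term_quot T)"
      by (auto simp: term_quot_def quotient_def)
    show "\<one>\<^bsub>term_quot T\<^esub> \<in> FHP // T"
      unfolding image[symmetric] one[symmetric] by simp
    show "x \<otimes>\<^bsub>term_quot T\<^esub> y \<in> FHP // T" if "x \<in> FHP // T" "y \<in> FHP // T" for x y
      using that unfolding image[symmetric] by (auto simp: mult[symmetric] hp_comp_fhp)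
  qed
  obtain star where inv: "inverse_monoid ?Q star"
    and star: "\<And>a. a \<in> fhp \<Longrightarrow> star (f a) = f (hp_inv a)"
    by (rule inverse_monoid_image[OF hp_inverse_monoid, of f ?Q]) (auto simp: image mult one)
  have le: "natural_le ?Q star (f a) (f b) \<longleftrightarrow> f (hp_comp (hp_comp a (hp_inv a)) b) = f a"
    if "a \<in> fhp" "b \<in> fhp" for a b
    using that by (simp add: natural_le_def star mult hp_inv_fhp hp_comp_fhp)
  have le_refl: "natural_le ?Q star (f a) (f a)" if "a \<in> fhp" for a
    using that by (simp add: le hp_comp_inv)
  have le_trim: "natural_le ?Q star (f a) (f (hp_trim a))" if "a \<in> fhp" for a
    using that by (simp add: le hp_trim_fhp hp_comp_trim)
  have sigma: "natural_le ?Q star (f u) (f (hp_trim t))"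
    if t: "t \<in> fhp" and u: "u \<in> fhp" and tu: "(f t, f u) \<in> sigma ?Q star" for t u
  proof (cases "T = UNIV")
    \<comment> \<open>Separation fails for the inconsistent theory, but there all classes coincide
      and reflexivity suffices.\<close>
    case True
    then have "f u = f (hp_trim t)" by (simp add: f_eq)
    then show ?thesis using le_refl[OF u] by simp
  next
    case False
    obtain w where w: "w \<in> fhp" "natural_le ?Q star (f w) (f t)" "natural_le ?Q star (f w) (f u)"
      using tu unfolding sigma_def image[symmetric] by auto
    have perm: "snd (v x) = snd (w x)" if v: "v \<in> fhp" "natural_le ?Q star (f w) (f v)" for v x
    proof -
      have "(hp_term (hp_comp (hp_comp w (hp_inv w)) v), hp_term w) \<in> T"
        using v w(1) by (simp add: le f_eq)
      then have "snd (hp_comp (hp_comp w (hp_inv w)) v x) = snd (w x)"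
        using v(1) w(1) by (intro theory_separation[OF T False] hp_comp_fhp hp_inv_fhp)
      then show ?thesis
        by (simp add: perm_hp_comp_id(1) perm_hp_comp_inv(1) w(1))
    qed
    have "hp_trim t = hp_trim u"
      by (rule hp_trim_cong) (simp add: fun_eq_iff perm t u w)
    then show ?thesis using le_trim[OF u] by simp
  qed
  have greatest: "\<exists>!m. m \<in> C \<and> (\<forall>v\<in>C. natural_le ?Q star m v \<longrightarrow> v = m)"
    if C_class: "C \<in> carrier ?Q // sigma ?Q star" for C
  proof -
    obtain t where t: "t \<in> fhp" and C: "C = sigma ?Q star `` {f t}"
      using C_class unfolding image[symmetric] by (auto elim!: quotientE)
    let ?m = "f (hp_trim t)"
    have CQ: "C \<subseteq> carrier ?Q" unfolding C sigma_def by auto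
    \<comment> \<open>The common lower bound of \<open>f t\<close> and \<open>?m\<close> is
      \<open>f t\<close> itself.\<close>
    have "?m \<in> C"
      using le_refl[OF t] le_trim[OF t] t hp_trim_fhp[OF t]
      unfolding C sigma_def image[symmetric] by auto
    moreover have max: "natural_le ?Q star v ?m" if v: "v \<in> C" for v
    proof -
      have "v \<in> f ` fhp" using v CQ image by auto
      then obtain u where "u \<in> fhp" "v = f u" by auto
      then show ?thesis using sigma[OF t] v unfolding C by auto
    qed
    \<comment> \<open>The greatest element is maximal by antisymmetry, and any maximal element lies
      below it and hence equals it.\<close>
    ultimately show ?thesis
      using natural_le_antisym[OF inv] CQ by blast
  qed
  have "F_inverse_monoid ?Q star"
    unfolding F_inverse_monoid_def by (intro conjI ballI inv greatest)
  then show "\<exists>star. F_inverse_monoid ?Q star" by (rule exI[of _ star])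
qed

end
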